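(* Let $\beta,\gamma>0$ with $\beta>r/2$, and $Q>0$ fixed. Consider the discretely observed model and prior described in the context, with prior $\vartheta_{mj}\sim\mathrm{N}(0,(c/m)^{2\beta/r}j^{-2\gamma-1})$ independently ($m=1,\dots,n$, $j=1,\dots,T$) for some $c\ge1$, and suppose the true trend values $f^*=(f_1^*,\dots,f_n^* )^{\mathrm T}$ have coefficients $\vartheta^*_{mj}$ satisfying $\sum_{i=1}^n\sum_{j=1}^T i^{2\beta/r}j^{2\gamma}(\vartheta^*_{ij})^2\le nTQ^2$. Then, with $T=T_n\to\infty$: (i) if $2\beta<r(2\gamma+1)$, the posterior contraction rate at $f^*$ with respect to $d_n$ is $\epsilon_{n,T}=(nT)^{-2\beta\gamma/(4\beta\gamma+2r\gamma+r)}$ upon choosing $c=(nT)^{r(2\gamma+1)/(4\beta\gamma+2r\gamma+r)}$; (ii) if $2\beta>r(2\gamma+1)$, the posterior contraction rate at $f^*$ with respect to $d_n$ is $\epsilon_{n,T}=(nT)^{-\gamma/(2\gamma+1)}$ upon choosing $c=(nT)^{r/(2\beta)}$; (iii) if $2\beta=r(2\gamma+1)$, the posterior contraction rate at $f^*$ with respect to $d_n$ is $\epsilon_{n,T}=(nT/\log(nT))^{-\gamma/(2\gamma+1)}$ upon choosing $c=(nT/\log(nT))^{1/(2\gamma+1)}$. Moreover, if $f_1^*,\dots,f_n^*$ are functions on $[0,1]$ that are uniformly Lipschitz continuous, then the posterior contraction rate for the full functions $(f_1,\dots,f_n)$, reconstructed from the values at the grid points by linear interpolation, with respect to the distance $\{n^{-1}\sum_{i=1}^n\int_0^1|f_i(t)-f_i^*(t)|^2dt\}^{1/2}$,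 is $\max\{\epsilon_{n,T},T^{-1}\}$.
   Context: Graph setting: for each $n$, $G$ is a connected undirected graph on $n$ nodes with graph Laplacian $\mathrm{L}=\mathrm{D}-\mathrm{A}$ (degree matrix minus adjacency matrix). Let $\lambda_1\le\cdots\le\lambda_n$ be its eigenvalues with orthonormal eigenvectors $e_1,\dots,e_n$, and let $e_{mi}$ denote the $i$-th coordinate of the eigenvector $e_m$. Standing assumption: $\lambda_i\asymp(i/n)^{2/r}$ for the relevant indices, with graph dimension $r\ge1$. Discrete model: grid points $k/T$, $k=1,\dots,T$, with $T=T_n$ growing with $n$. Observations $Y_i(k/T)=f_i(k/T)+\varepsilon_{ik}$, $i=1,\dots,n$, $k=1,\dots,T$, with $\varepsilon_{ik}$ i.i.d. $\mathrm{N}(0,\sigma^2)$, $\sigma$ known. Let $\psi_1,\dots,\psi_T$ be a discrete wavelet transform basis on the grid, i.e. the $T\times T$ matrix $(\psi_j(k/T))_{j,k}$ is orthogonal. The trend values are parametrized as $f_i(k/T)=\sum_{m=1}^n\sum_{j=1}^T\vartheta_{mj}e_{mi}\psi_j(k/T)$. Metric: $d_n(f,f^* )=\{(nT)^{-1}\sum_{i=1}^n\sum_{k=1}^T|f_i(k/T)-f_i^*(k/T)|^2\}^{1/2}$. Posterior contraction rate $\epsilon_{n,T}$ at $f^*$ w.r.t. a distance $d$ means: for every $M_n\to\infty$, $\mathrm{E}_{f^*}\Pi(f:d(f,f^* )>M_n\epsilon_{n,T}\mid\text{data})\to0$. *)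

theory Defs
  imports "HOL-Probability.Probability"
begin

definition simple_graph :: "nat \<Rightarrow> (nat \<Rightarrow> nat \<Rightarrow> bool) \<Rightarrow> bool" where
  "simple_graph n Eg \<longleftrightarrow>
     (\<forall>i l. Eg i l \<longrightarrow> i \<in> {1..n} \<and> l \<in> {1..n} \<and> i \<noteq> l \<and> Eg l i)"

definition connected_graph :: "nat \<Rightarrow> (nat \<Rightarrow> nat \<Rightarrow> bool) \<Rightarrow> bool" where
  "connected_graph n Eg \<longleftrightarrow> simple_graph n Eg \<and> (\<forall>i\<in>{1..n}. \<forall>l\<in>{1..n}. Eg\<^sup>*\<^sup>* i l)"

definition laplacian :: "nat \<Rightarrow> (nat \<Rightarrow> nat \<Rightarrow> bool) \<Rightarrow> nat \<Rightarrow> nat \<Rightarrow> real" where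
  "laplacian n Eg i l =
     (if i = l then real (card {v\<in>{1..n}. Eg i v}) else 0) - (if Eg i l then 1 else 0)"

definition laplacian_eigensystem ::
  "nat \<Rightarrow> (nat \<Rightarrow> nat \<Rightarrow> bool) \<Rightarrow> (nat \<Rightarrow> real) \<Rightarrow> (nat \<Rightarrow> nat \<Rightarrow> real) \<Rightarrow> bool" where
  "laplacian_eigensystem n Eg lam e \<longleftrightarrow>
     (\<forall>m\<in>{1..n}. \<forall>i\<in>{1..n}. (\<Sum>l=1..n. laplacian n Eg i l * e m l) = lam m * e m i) \<and>
     (\<forall>m\<in>{1..n}. \<forall>m'\<in>{1..n}. (\<Sum>i=1..n. e m i * e m' i) = (if m = m' then 1 else 0)) \<and>
     (\<forall>m\<in>{1..n}. \<forall>m'\<in>{1..n}. m \<le> m' \<longrightarrow> lam m \<le> lam m')"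

section \<open>Discrete wavelet basis: psi j k = psi_j(k/T), an orthogonal T x T matrix\<close>

definition orthogonal_basis_matrix :: "nat \<Rightarrow> (nat \<Rightarrow> nat \<Rightarrow> real) \<Rightarrow> bool" where
  "orthogonal_basis_matrix T psi \<longleftrightarrow>
     (\<forall>j\<in>{1..T}. \<forall>j'\<in>{1..T}. (\<Sum>k=1..T. psi j k * psi j' k) = (if j = j' then 1 else 0))"

definition Iset :: "nat \<Rightarrow> nat \<Rightarrow> (nat \<times> nat) set" where
  "Iset n T = {1..n} \<times> {1..T}"

definition ftrend :: "nat \<Rightarrow> nat \<Rightarrow> (nat \<Rightarrow> nat \<Rightarrow> real) \<Rightarrow> (nat \<Rightarrow> nat \<Rightarrow> real)
    \<Rightarrow> (nat \<times> nat \<Rightarrow> real) \<Rightarrow> nat \<Rightarrow> nat \<Rightarrow> real" where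
  "ftrend n T e psi th i k = (\<Sum>m=1..n. \<Sum>j=1..T. th (m, j) * e m i * psi j k)"

definition data_law :: "nat \<Rightarrow> nat \<Rightarrow> (nat \<Rightarrow> nat \<Rightarrow> real) \<Rightarrow> real \<Rightarrow> (nat \<times> nat \<Rightarrow> real) measure" where
  "data_law n T f \<sigma> = PiM (Iset n T) (\<lambda>(i,k). density lborel (normal_density (f i k) \<sigma>))"

definition prior :: "nat \<Rightarrow> nat \<Rightarrow> real \<Rightarrow> real \<Rightarrow> real \<Rightarrow> real \<Rightarrow> (nat \<times> nat \<Rightarrow> real) measure" where
  "prior n T c \<beta> \<gamma> r = PiM (Iset n T) (\<lambda>(m,j). density lborel
      (normal_density 0 (sqrt ((c / real m) powr (2 * \<beta> / r) * real j powr (- 2 * \<gamma> - 1)))))"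

definition likelihood :: "nat \<Rightarrow> nat \<Rightarrow> (nat \<Rightarrow> nat \<Rightarrow> real) \<Rightarrow> (nat \<Rightarrow> nat \<Rightarrow> real) \<Rightarrow> real
    \<Rightarrow> (nat \<times> nat \<Rightarrow> real) \<Rightarrow> (nat \<times> nat \<Rightarrow> real) \<Rightarrow> real" where
  "likelihood n T e psi \<sigma> th Y = (\<Prod>(i,k)\<in>Iset n T. normal_density (ftrend n T e psi th i k) \<sigma> (Y (i,k)))"

definition posterior :: "nat \<Rightarrow> nat \<Rightarrow> (nat \<Rightarrow> nat \<Rightarrow> real) \<Rightarrow> (nat \<Rightarrow> nat \<Rightarrow> real) \<Rightarrow> real
    \<Rightarrow> (nat \<times> nat \<Rightarrow> real) measure \<Rightarrow> (nat \<times> nat \<Rightarrow> real) set \<Rightarrow> (nat \<times> nat \<Rightarrow> real) \<Rightarrow> real" where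
  "posterior n T e psi \<sigma> Pr B Y =
     (\<integral>th. indicator B th * likelihood n T e psi \<sigma> th Y \<partial>Pr) / (\<integral>th. likelihood n T e psi \<sigma> th Y \<partial>Pr)"

definition dn :: "nat \<Rightarrow> nat \<Rightarrow> (nat \<Rightarrow> nat \<Rightarrow> real) \<Rightarrow> (nat \<Rightarrow> nat \<Rightarrow> real) \<Rightarrow> real" where
  "dn n T f g = sqrt ((1 / (real n * real T)) * (\<Sum>i=1..n. \<Sum>k=1..T. \<bar>f i k - g i k\<bar>\<^sup>2))"

definition lin_interp :: "nat \<Rightarrow> (nat \<Rightarrow> real) \<Rightarrow> real \<Rightarrow> real" where
  "lin_interp T v t =
     (if t \<le> 1 / real T then v 1
      else let k = nat \<lfloor>t * real T\<rfloor> in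
        if k \<ge> T then v T else v k + (t * real T - real k) * (v (Suc k) - v k))"

definition dL2 :: "nat \<Rightarrow> (nat \<Rightarrow> real \<Rightarrow> real) \<Rightarrow> (nat \<Rightarrow> real \<Rightarrow> real) \<Rightarrow> real" where
  "dL2 n f g = sqrt ((1 / real n) * (\<Sum>i=1..n. integral {0..1} (\<lambda>t. \<bar>f i t - g i t\<bar>\<^sup>2)))"

text \<open>Posterior contraction: for every M_n \<rightarrow> \<infinity>,
  E_{f*} Pi(th : dist_n(th) > M_n eps_n | data) \<rightarrow> 0.  Here Post n B Y is the posterior
  probability of B given data Y at stage n, Pdata n is the true law of the data and
  dist n th is the distance between the trend parametrized by th and the truth.\<close>
definition posterior_contracts ::
  "(nat \<Rightarrow> 'p set \<Rightarrow> 'y \<Rightarrow> real) \<Rightarrow> (nat \<Rightarrow> 'y measure) \<Rightarrow> (nat \<Rightarrow> 'p \<Rightarrow> real)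
     \<Rightarrow> (nat \<Rightarrow> real) \<Rightarrow> bool" where
  "posterior_contracts Post Pdata dst eps \<longleftrightarrow>
     (\<forall>M :: nat \<Rightarrow> real. filterlim M at_top sequentially \<longrightarrow>
        ((\<lambda>n. \<integral>Y. Post n {th. dst n th > M n * eps n} Y \<partial>(Pdata n)) \<longlongrightarrow> 0) sequentially)"

definition model_result ::
  "(nat \<Rightarrow> nat) \<Rightarrow> (nat \<Rightarrow> nat \<Rightarrow> nat \<Rightarrow> real) \<Rightarrow> (nat \<Rightarrow> nat \<Rightarrow> nat \<Rightarrow> real) \<Rightarrow> real
    \<Rightarrow> real \<Rightarrow> real \<Rightarrow> real \<Rightarrow> (nat \<Rightarrow> nat \<times> nat \<Rightarrow> real) \<Rightarrow> (nat \<Rightarrow> real) \<Rightarrow> (nat \<Rightarrow> real) \<Rightarrow> bool" where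
  "model_result T e psi \<sigma> \<beta> \<gamma> r th0 c eps \<longleftrightarrow>
     posterior_contracts
       (\<lambda>n. posterior n (T n) (e n) (psi n) \<sigma> (prior n (T n) (c n) \<beta> \<gamma> r))
       (\<lambda>n. data_law n (T n) (ftrend n (T n) (e n) (psi n) (th0 n)) \<sigma>)
       (\<lambda>n th. dn n (T n) (ftrend n (T n) (e n) (psi n) th) (ftrend n (T n) (e n) (psi n) (th0 n)))
       eps
   \<and> (\<forall>F :: nat \<Rightarrow> nat \<Rightarrow> real \<Rightarrow> real.
        (\<exists>L. \<forall>n. \<forall>i\<in>{1..n}. \<forall>s\<in>{0..1}. \<forall>t\<in>{0..1}. \<bar>F n i s - F n i t\<bar> \<le> L * \<bar>s - t\<bar>) \<and>
        (\<forall>n. \<forall>i\<in>{1..n}. \<forall>k\<in>{1..T n}.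
            F n i (real k / real (T n)) = ftrend n (T n) (e n) (psi n) (th0 n) i k)
        \<longrightarrow>
        posterior_contracts
          (\<lambda>n. posterior n (T n) (e n) (psi n) \<sigma> (prior n (T n) (c n) \<beta> \<gamma> r))
          (\<lambda>n. data_law n (T n) (ftrend n (T n) (e n) (psi n) (th0 n)) \<sigma>)
          (\<lambda>n th. dL2 n (\<lambda>i. lin_interp (T n) (ftrend n (T n) (e n) (psi n) th i)) (F n))
          (\<lambda>n. max (eps n) (1 / real (T n))))"

end

theory Submission
  imports Defs "HOL-Analysis.Harmonic_Numbers"
begin

text \<open>In the coefficients with respect to the orthonormal system \<open>e m i * psi j k\<close> the posterior is a
  product of univariate Gaussians, so by Markov's inequality the expected posterior mass of a \<open>dn\<close>-ball
  complement is at most the posterior second moment around the truth, a sum over \<open>(m, j)\<close> of variance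
  terms of order \<open>min 1 v\<close> and bias terms \<open>(\<sigma>\<^sup>2 / (v + \<sigma>\<^sup>2))\<^sup>2 (th0 (m, j))\<^sup>2\<close>, where \<open>v\<close> is the prior variance.
  The bias factor is at most a constant times \<open>v powr (- a)\<close> with \<open>a = 2 \<gamma> / (2 \<gamma> + 1)\<close>, which makes the powers of
  \<open>j\<close> cancel against the smoothness condition. In the variance sum one sums first over
  the index with the smaller prior exponent; for equal exponents a harmonic sum remains, hence the
  logarithm. Linear interpolation is a convex combination
  of neighbouring grid values, so it costs at most a factor and a term of order \<open>1 / T\<close>.\<close>

section \<open>Moments under products of Gaussian measures\<close>

lemma
  fixes f :: "'i \<Rightarrow> 'a \<Rightarrow> real"
  assumes I: "finite I" and M: "\<And>i. i \<in> I \<Longrightarrow> prob_space (M i)"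
    and f: "\<And>i. i \<in> I \<Longrightarrow> integrable (M i) (f i)"
  shows integrable_PiM_prod: "integrable (PiM I M) (\<lambda>x. \<Prod>i\<in>I. f i (x i))"
    and integral_PiM_prod: "(\<integral>x. (\<Prod>i\<in>I. f i (x i)) \<partial>PiM I M) = (\<Prod>i\<in>I. \<integral>t. f i t \<partial>M i)"
proof -
  \<comment> \<open>The product locale wants a sigma-finite measure at every index, so indices
    outside \<open>I\<close> receive a point mass; \<open>PiM\<close> over \<open>I\<close> does not
    see the change.\<close>
  define M' where "M' = (\<lambda>i. if i \<in> I then M i else return (count_space UNIV) undefined)"
  have eq: "PiM I M = PiM I M'" by (intro PiM_cong) (auto simp: M'_def)
  have p: "prob_space (M' i)" for i by (auto simp: M'_def M intro!: prob_space_return)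
  interpret product_sigma_finite M'
    by unfold_locales (metis p prob_space_imp_sigma_finite sigma_finite_measure.sigma_finite_countable)
  have f': "\<And>i. i \<in> I \<Longrightarrow> integrable (M' i) (f i)" using f by (simp add: M'_def)
  show "integrable (PiM I M) (\<lambda>x. \<Prod>i\<in>I. f i (x i))"
    unfolding eq by (rule product_integrable_prod[OF I f'])
  show "(\<integral>x. (\<Prod>i\<in>I. f i (x i)) \<partial>PiM I M) = (\<Prod>i\<in>I. \<integral>t. f i t \<partial>M i)"
    unfolding eq by (subst product_integral_prod[OF I f']) (auto simp: M'_def)
qed

lemma normal_centred_moments:
  fixes \<mu> \<sigma> a :: real
  assumes "\<sigma> > 0"
  shows "has_bochner_integral lborel (\<lambda>x. normal_density \<mu> \<sigma> x) 1"
    and "has_bochner_integral lborel (\<lambda>x. normal_density \<mu> \<sigma> x * (x - \<mu>)) 0"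
    and "has_bochner_integral lborel (\<lambda>x. normal_density \<mu> \<sigma> x * (x - \<mu>)\<^sup>2) (\<sigma>\<^sup>2)"
    and "has_bochner_integral lborel (\<lambda>x. normal_density \<mu> \<sigma> x * (x - a)\<^sup>2) (\<sigma>\<^sup>2 + (\<mu> - a)\<^sup>2)"
proof -
  show 0: "has_bochner_integral lborel (\<lambda>x. normal_density \<mu> \<sigma> x) 1"
    using normal_moment_even[OF assms, of \<mu> 0] by simp
  show 1: "has_bochner_integral lborel (\<lambda>x. normal_density \<mu> \<sigma> x * (x - \<mu>)) 0"
    using normal_moment_odd[OF assms, of \<mu> 0] by simp
  show 2: "has_bochner_integral lborel (\<lambda>x. normal_density \<mu> \<sigma> x * (x - \<mu>)\<^sup>2) (\<sigma>\<^sup>2)"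
    using normal_moment_even[OF assms, of \<mu> 1] by (simp add: fact_numeral power_divide assms)
  have "has_bochner_integral lborel (\<lambda>x. normal_density \<mu> \<sigma> x * (x - \<mu>)\<^sup>2
      + (normal_density \<mu> \<sigma> x * (x - \<mu>)) * (2 * (\<mu> - a)) + normal_density \<mu> \<sigma> x * (\<mu> - a)\<^sup>2)
      (\<sigma>\<^sup>2 + 0 * (2 * (\<mu> - a)) + 1 * (\<mu> - a)\<^sup>2)"
    by (intro has_bochner_integral_add has_bochner_integral_mult_left 0 1 2)
  also have "(\<lambda>x. normal_density \<mu> \<sigma> x * (x - \<mu>)\<^sup>2
      + (normal_density \<mu> \<sigma> x * (x - \<mu>)) * (2 * (\<mu> - a)) + normal_density \<mu> \<sigma> x * (\<mu> - a)\<^sup>2)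
     = (\<lambda>x. normal_density \<mu> \<sigma> x * (x - a)\<^sup>2)"
    by (intro ext) algebra
  finally show "has_bochner_integral lborel (\<lambda>x. normal_density \<mu> \<sigma> x * (x - a)\<^sup>2) (\<sigma>\<^sup>2 + (\<mu> - a)\<^sup>2)"
    by simp
qed

lemma has_bochner_integral_normal:
  fixes g :: "real \<Rightarrow> real"
  assumes "has_bochner_integral lborel (\<lambda>x. normal_density \<mu> \<sigma> x * g x) c" "g \<in> borel_measurable borel"
  shows "integrable (density lborel (normal_density \<mu> \<sigma>)) g"
    and "(\<integral>x. g x \<partial>density lborel (normal_density \<mu> \<sigma>)) = c"
  using assms by (auto simp: integrable_density integral_density has_bochner_integral_iff)

text \<open>Independence and centring kill the mixed and the linear terms of the expanded square,
  and only the diagonal survives. The form serves for the error of a posterior mean coordinate: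
  linear noise plus a deterministic bias \<open>b\<close>.\<close>

lemma PiM_normal_linear_form:
  fixes a \<mu> :: "'i \<Rightarrow> real" and \<sigma> b :: real
  assumes I: "finite I" and s: "\<sigma> > 0"
  shows "has_bochner_integral (PiM I (\<lambda>i. density lborel (normal_density (\<mu> i) \<sigma>)))
           (\<lambda>Y. ((\<Sum>i\<in>I. a i * (Y i - \<mu> i)) + b)\<^sup>2) (\<sigma>\<^sup>2 * (\<Sum>i\<in>I. (a i)\<^sup>2) + b\<^sup>2)"
proof -
  let ?N = "\<lambda>i. density lborel (normal_density (\<mu> i) \<sigma>)"
  let ?P = "PiM I ?N"
  have p: "prob_space (?N i)" for i by (rule prob_space_normal_density[OF s])
  interpret P: prob_space ?P by (intro prob_space_PiM p)
  note m = normal_centred_moments[OF s]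
  have i0: "integrable (?N i) (\<lambda>_. 1::real)" "(\<integral>t. 1 \<partial>?N i) = (1::real)" for i
    using has_bochner_integral_normal[of "\<mu> i" \<sigma> "\<lambda>_. 1" 1] m(1) by auto
  have i1: "integrable (?N i) (\<lambda>t. t - \<mu> i)" "(\<integral>t. t - \<mu> i \<partial>?N i) = 0" for i
    using has_bochner_integral_normal[OF m(2)] by auto
  have i2: "integrable (?N i) (\<lambda>t. (t - \<mu> i)\<^sup>2)" "(\<integral>t. (t - \<mu> i)\<^sup>2 \<partial>?N i) = \<sigma>\<^sup>2" for i
    using has_bochner_integral_normal[OF m(3)] by auto
  have one: "has_bochner_integral ?P (\<lambda>Y. Y x - \<mu> x) 0" if "x \<in> I" for x
  proof -
    \<comment> \<open>One coordinate is written as a product over all of \<open>I\<close> with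
      factors 1 elsewhere, so that the product formula for integrals applies.\<close>
    let ?g = "\<lambda>i t. if i = x then t - \<mu> i else 1"
    have g: "integrable (?N i) (?g i)" for i by (cases "i = x") (use i0 i1 in auto)
    have "(\<lambda>Y. \<Prod>i\<in>I. ?g i (Y i)) = (\<lambda>Y. Y x - \<mu> x)"
      using that I by (simp add: prod.delta)
    moreover have "(\<Prod>i\<in>I. \<integral>t. ?g i t \<partial>?N i) = 0"
      using that I i1 by (intro prod_zero bexI[of _ x]) auto
    ultimately show ?thesis
      using integrable_PiM_prod[of I ?N ?g, OF I p g] integral_PiM_prod[of I ?N ?g, OF I p g]
      by (simp add: has_bochner_integral_iff)
  qed
  have two: "has_bochner_integral ?P (\<lambda>Y. (Y x - \<mu> x) * (Y y - \<mu> y)) (if y = x then \<sigma>\<^sup>2 else 0)"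
    if x: "x \<in> I" and y: "y \<in> I" for x y
  proof -
    \<comment> \<open>Multiplying two conditionals covers both cases: for \<open>x = y\<close> the
      square sits at one index, otherwise the factor at \<open>x\<close> has mean 0.\<close>
    let ?g = "\<lambda>i t. (if i = x then t - \<mu> i else 1) * (if i = y then t - \<mu> i else 1)"
    have g: "integrable (?N i) (?g i)" for i
      by (cases "i = x"; cases "i = y") (use i0 i1 i2 in \<open>auto simp: power2_eq_square\<close>)
    have "(\<lambda>Y. \<Prod>i\<in>I. ?g i (Y i)) = (\<lambda>Y. (Y x - \<mu> x) * (Y y - \<mu> y))"
      using x y I by (simp add: prod.distrib prod.delta)
    moreover have "(\<Prod>i\<in>I. \<integral>t. ?g i t \<partial>?N i) = (if y = x then \<sigma>\<^sup>2 else 0)"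
    proof (cases "y = x")
      case True
      then have "(\<Prod>i\<in>I. \<integral>t. ?g i t \<partial>?N i) = (\<Prod>i\<in>I. if i = x then \<sigma>\<^sup>2 else 1)"
        using i0 i2 by (intro prod.cong) (auto simp: power2_eq_square)
      then show ?thesis using True x I by (simp add: prod.delta)
    next
      case False
      then have "(\<integral>t. ?g x t \<partial>?N x) = 0" using i1 by simp
      then show ?thesis using False x I by (auto intro!: prod_zero bexI[of _ x])
    qed
    ultimately show ?thesis
      using integrable_PiM_prod[of I ?N ?g, OF I p g] integral_PiM_prod[of I ?N ?g, OF I p g]
      by (simp add: has_bochner_integral_iff)
  qed
  have "has_bochner_integral ?P (\<lambda>Y. (\<Sum>x\<in>I. \<Sum>y\<in>I. (a x * a y) * ((Y x - \<mu> x) * (Y y - \<mu> y)))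
        + (\<Sum>x\<in>I. (2 * b * a x) * (Y x - \<mu> x)) + b\<^sup>2)
     ((\<Sum>x\<in>I. \<Sum>y\<in>I. (a x * a y) * (if y = x then \<sigma>\<^sup>2 else 0)) + (\<Sum>x\<in>I. (2 * b * a x) * 0) + b\<^sup>2)"
    using one two
    by (intro has_bochner_integral_add has_bochner_integral_sum has_bochner_integral_mult_right)
       (auto simp: has_bochner_integral_iff P.prob_space)
  moreover have "(\<Sum>x\<in>I. \<Sum>y\<in>I. (a x * a y) * (if y = x then \<sigma>\<^sup>2 else 0)) = \<sigma>\<^sup>2 * (\<Sum>x\<in>I. (a x)\<^sup>2)"
    using I by (simp add: if_distrib sum.delta power2_eq_square sum_distrib_left mult_ac cong: if_cong)
  moreover have "(\<Sum>x\<in>I. \<Sum>y\<in>I. (a x * a y) * ((Y x - \<mu> x) * (Y y - \<mu> y)))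
        + (\<Sum>x\<in>I. (2 * b * a x) * (Y x - \<mu> x)) + b\<^sup>2 = ((\<Sum>i\<in>I. a i * (Y i - \<mu> i)) + b)\<^sup>2" for Y
    by (simp add: power2_sum power2_eq_square[of "sum _ _"] sum_product sum_distrib_left sum_distrib_right mult_ac)
  ultimately show ?thesis by simp
qed

section \<open>Gaussian conjugacy and the posterior second moment\<close>

text \<open>The weight of the posterior mean on the observation when the prior has standard
  deviation \<open>s\<close> and the noise \<open>\<sigma>\<close>;
  \<open>shrink \<sigma> s * \<sigma>\<^sup>2\<close> is the posterior variance.\<close>

definition shrink :: "real \<Rightarrow> real \<Rightarrow> real" where
  "shrink \<sigma> s = s\<^sup>2 / (s\<^sup>2 + \<sigma>\<^sup>2)"

text \<open>Splits off the factor that carries the mean, so that a likelihood becomes a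
  parameter-free density times the exponential of a quadratic.\<close>

lemma normal_density_shift:
  assumes "\<sigma> > 0"
  shows "normal_density \<mu> \<sigma> y = normal_density 0 \<sigma> y * exp ((2 * y * \<mu> - \<mu>\<^sup>2) / (2 * \<sigma>\<^sup>2))"
proof -
  have "- (y - \<mu>)\<^sup>2 / (2 * \<sigma>\<^sup>2) = - (y - 0)\<^sup>2 / (2 * \<sigma>\<^sup>2) + (2 * y * \<mu> - \<mu>\<^sup>2) / (2 * \<sigma>\<^sup>2)"
    using assms by (simp add: field_simps power2_eq_square)
  then have "exp (- (y - \<mu>)\<^sup>2 / (2 * \<sigma>\<^sup>2))
      = exp (- (y - 0)\<^sup>2 / (2 * \<sigma>\<^sup>2)) * exp ((2 * y * \<mu> - \<mu>\<^sup>2) / (2 * \<sigma>\<^sup>2))"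
    by (simp only: exp_add)
  then show ?thesis unfolding normal_density_def by simp
qed

text \<open>Completing the square turns the prior density times \<open>g\<close> into a multiple of
  a normal density with mean \<open>shrink \<sigma> s * Z\<close> and variance
  \<open>shrink \<sigma> s * \<sigma>\<^sup>2\<close>. The second moment keeps the total mass as a
  factor, since that mass cancels in the posterior quotient.\<close>

lemma gaussian_conjugacy:
  fixes \<sigma> s Z a :: real
  assumes \<sigma>: "\<sigma> > 0" and s: "s > 0"
  defines "N \<equiv> density lborel (normal_density 0 s)"
    and "g \<equiv> \<lambda>t. exp ((2 * Z * t - t\<^sup>2) / (2 * \<sigma>\<^sup>2))"
  shows "integrable N g" and "0 < (\<integral>t. g t \<partial>N)"
    and "integrable N (\<lambda>t. (t - a)\<^sup>2 * g t)"
    and "(\<integral>t. (t - a)\<^sup>2 * g t \<partial>N) = (shrink \<sigma> s * \<sigma>\<^sup>2 + (shrink \<sigma> s * Z - a)\<^sup>2) * (\<integral>t. g t \<partial>N)"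
proof -
  define \<rho> where "\<rho> = shrink \<sigma> s"
  define \<tau> where "\<tau> = sqrt (\<rho> * \<sigma>\<^sup>2)"
  have den: "s\<^sup>2 + \<sigma>\<^sup>2 > 0" using \<sigma> by (simp add: add_nonneg_pos)
  have \<rho>: "\<rho> > 0" using s den by (simp add: \<rho>_def shrink_def)
  have \<tau>: "\<tau> > 0" "\<tau>\<^sup>2 = \<rho> * \<sigma>\<^sup>2" using \<rho> \<sigma> by (auto simp: \<tau>_def)
  \<comment> \<open>The constant left over from completing the square, times the ratio of the two
    normalising constants.\<close>
  define K where "K = exp (\<rho> * Z\<^sup>2 / (2 * \<sigma>\<^sup>2)) * (sqrt (2 * pi * \<tau>\<^sup>2) / sqrt (2 * pi * s\<^sup>2))"
  have K: "K > 0" using \<tau>(1) s by (simp add: K_def)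
  have tilt: "normal_density 0 s t * g t = K * normal_density (\<rho> * Z) \<tau> t" for t
  proof -
    have "- (t - 0)\<^sup>2 / (2 * s\<^sup>2) + (2 * Z * t - t\<^sup>2) / (2 * \<sigma>\<^sup>2)
        = - (t - \<rho> * Z)\<^sup>2 / (2 * \<tau>\<^sup>2) + \<rho> * Z\<^sup>2 / (2 * \<sigma>\<^sup>2)"
    proof -
      \<comment> \<open>The precisions of prior and noise add up to the posterior precision.\<close>
      have i: "1 / (\<rho> * \<sigma>\<^sup>2) = 1 / s\<^sup>2 + 1 / \<sigma>\<^sup>2"
        using s \<sigma> den by (simp add: \<rho>_def shrink_def field_simps)
      have "- (t - \<rho> * Z)\<^sup>2 / (2 * \<tau>\<^sup>2)
          = - (t\<^sup>2 / 2) * (1 / (\<rho> * \<sigma>\<^sup>2)) + Z * t / \<sigma>\<^sup>2 - \<rho> * Z\<^sup>2 / (2 * \<sigma>\<^sup>2)"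
        unfolding \<tau>(2) using \<rho> \<sigma> by (simp add: field_simps power2_eq_square)
      then show ?thesis unfolding i using s \<sigma> by (simp add: field_simps)
    qed
    then have "exp (- (t - 0)\<^sup>2 / (2 * s\<^sup>2)) * g t
        = exp (- (t - \<rho> * Z)\<^sup>2 / (2 * \<tau>\<^sup>2)) * exp (\<rho> * Z\<^sup>2 / (2 * \<sigma>\<^sup>2))"
      unfolding g_def by (simp only: exp_add[symmetric])
    then show ?thesis
      unfolding normal_density_def K_def using \<tau>(1) s by (simp add: field_simps)
  qed
  note m = normal_centred_moments[OF \<tau>(1), of "\<rho> * Z"]
  have meas: "g \<in> borel_measurable borel" unfolding g_def by measurable
  have 1: "has_bochner_integral lborel (\<lambda>t. normal_density 0 s t * g t) (K * 1)"
    unfolding tilt by (intro has_bochner_integral_mult_right m(1))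
  have 2: "has_bochner_integral lborel (\<lambda>t. normal_density 0 s t * ((t - a)\<^sup>2 * g t)) (K * (\<tau>\<^sup>2 + (\<rho> * Z - a)\<^sup>2))"
  proof -
    have "normal_density 0 s t * ((t - a)\<^sup>2 * g t) = K * (normal_density (\<rho> * Z) \<tau> t * (t - a)\<^sup>2)" for t
      using tilt[of t] by (simp add: mult_ac)
    then show ?thesis by (simp only: has_bochner_integral_mult_right[OF m(4)])
  qed
  show "integrable N g" and "integrable N (\<lambda>t. (t - a)\<^sup>2 * g t)"
    unfolding N_def using has_bochner_integral_normal[OF 1 meas]
      has_bochner_integral_normal[OF 2] meas by auto
  have v: "(\<integral>t. g t \<partial>N) = K" "(\<integral>t. (t - a)\<^sup>2 * g t \<partial>N) = K * (\<tau>\<^sup>2 + (\<rho> * Z - a)\<^sup>2)"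
    unfolding N_def using has_bochner_integral_normal[OF 1 meas]
      has_bochner_integral_normal[OF 2] meas by auto
  show "0 < (\<integral>t. g t \<partial>N)" using v K by simp
  show "(\<integral>t. (t - a)\<^sup>2 * g t \<partial>N) = (shrink \<sigma> s * \<sigma>\<^sup>2 + (shrink \<sigma> s * Z - a)\<^sup>2) * (\<integral>t. g t \<partial>N)"
    unfolding v \<rho>_def[symmetric] \<tau>(2)[symmetric] by simp
qed

text \<open>The part of the likelihood outside the span of \<open>b\<close> does not depend on the parameter and cancels in
  the posterior.\<close>
lemma gaussian_sequence_posterior_tail:
  fixes b :: "'i \<Rightarrow> 'i \<Rightarrow> real" and s th0 :: "'i \<Rightarrow> real" and \<sigma> \<delta> :: real
  assumes I: "finite I" and \<sigma>: "\<sigma> > 0" and s: "\<And>x. x \<in> I \<Longrightarrow> s x > 0"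
    and orth: "\<And>x y. x \<in> I \<Longrightarrow> y \<in> I \<Longrightarrow> (\<Sum>z\<in>I. b x z * b y z) = (if x = y then 1 else 0)"
    and \<delta>: "\<delta> > 0" and B: "B \<subseteq> {th. \<delta> \<le> (\<Sum>x\<in>I. (th x - th0 x)\<^sup>2)}"
  defines "f \<equiv> \<lambda>th z. \<Sum>x\<in>I. th x * b x z"
    and "Pr \<equiv> PiM I (\<lambda>x. density lborel (normal_density 0 (s x)))"
  defines "Lik \<equiv> \<lambda>th Y. \<Prod>z\<in>I. normal_density (f th z) \<sigma> (Y z)"
  defines "Post \<equiv> \<lambda>Y. (\<integral>th. indicator B th * Lik th Y \<partial>Pr) / (\<integral>th. Lik th Y \<partial>Pr)"
  shows "0 \<le> (\<integral>Y. Post Y \<partial>PiM I (\<lambda>z. density lborel (normal_density (f th0 z) \<sigma>)))"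
    and "(\<integral>Y. Post Y \<partial>PiM I (\<lambda>z. density lborel (normal_density (f th0 z) \<sigma>)))
      \<le> (\<Sum>x\<in>I. shrink \<sigma> (s x) * \<sigma>\<^sup>2 + (shrink \<sigma> (s x))\<^sup>2 * \<sigma>\<^sup>2
               + (1 - shrink \<sigma> (s x))\<^sup>2 * (th0 x)\<^sup>2) / \<delta>"
proof -
  let ?N = "\<lambda>x. density lborel (normal_density 0 (s x))"
  let ?D = "PiM I (\<lambda>z. density lborel (normal_density (f th0 z) \<sigma>))"
  \<comment> \<open>\<open>Z Y x\<close> is the coefficient of the data along \<open>b x\<close>.
    Below, \<open>K\<close> collects the factor of the likelihood that is free of the parameter, and
    \<open>R Y\<close> will be the posterior second moment around \<open>th0\<close>.\<close>
  define Z where "Z = (\<lambda>Y x. \<Sum>z\<in>I. b x z * Y z)"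
  define g where "g = (\<lambda>Y x t. exp ((2 * Z Y x * t - t\<^sup>2) / (2 * \<sigma>\<^sup>2)))"
  define \<rho> where "\<rho> = (\<lambda>x. shrink \<sigma> (s x))"
  define K where "K = (\<lambda>Y. \<Prod>z\<in>I. normal_density 0 \<sigma> (Y z))"
  define R where "R = (\<lambda>Y. \<Sum>x\<in>I. \<rho> x * \<sigma>\<^sup>2 + (\<rho> x * Z Y x - th0 x)\<^sup>2)"
  have p: "prob_space (?N x)" if "x \<in> I" for x
    by (rule prob_space_normal_density[OF s[OF that]])
  interpret D: prob_space ?D by (intro prob_space_PiM prob_space_normal_density \<sigma>)
  have Zf: "Z (f th) x = th x" if "x \<in> I" for x th
  proof -
    have "Z (f th) x = (\<Sum>y\<in>I. th y * (\<Sum>z\<in>I. b x z * b y z))"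
      unfolding Z_def f_def sum_distrib_left by (subst sum.swap) (simp add: mult_ac)
    also have "\<dots> = (\<Sum>y\<in>I. if x = y then th y else 0)"
      using that by (intro sum.cong) (auto simp: orth)
    finally show ?thesis using I that by simp
  qed
  have inner: "(\<Sum>z\<in>I. Y z * f th z) = (\<Sum>x\<in>I. Z Y x * th x)" for Y th
    unfolding Z_def f_def sum_distrib_left sum_distrib_right
    by (subst sum.swap) (simp add: mult_ac)
  have K: "K Y > 0" for Y unfolding K_def using \<sigma> by (intro prod_pos) (simp add: normal_density_pos)
  have Lik: "Lik th Y = K Y * (\<Prod>x\<in>I. g Y x (th x))" for th Y
  proof -
    have "(\<Sum>z\<in>I. 2 * Y z * f th z - (f th z)\<^sup>2) = 2 * (\<Sum>z\<in>I. Y z * f th z) - (\<Sum>z\<in>I. f th z * f th z)"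
      by (simp add: sum_subtractf sum_distrib_left power2_eq_square mult_ac)
    \<comment> \<open>Here \<open>inner\<close> is also used with \<open>f th\<close> as data; with
      \<open>Zf\<close> it says that \<open>f\<close> preserves the Euclidean norm, so the exponent
      separates over the coordinates.\<close>
    also have "\<dots> = (\<Sum>x\<in>I. 2 * Z Y x * th x - (th x)\<^sup>2)"
      unfolding inner by (simp add: Zf sum_subtractf sum_distrib_left power2_eq_square mult_ac)
    finally have *: "(\<Sum>z\<in>I. (2 * Y z * f th z - (f th z)\<^sup>2) / (2 * \<sigma>\<^sup>2))
        = (\<Sum>x\<in>I. (2 * Z Y x * th x - (th x)\<^sup>2) / (2 * \<sigma>\<^sup>2))"
      by (simp only: sum_divide_distrib[symmetric])
    have "Lik th Y = K Y * exp (\<Sum>z\<in>I. (2 * Y z * f th z - (f th z)\<^sup>2) / (2 * \<sigma>\<^sup>2))"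
      unfolding Lik_def K_def exp_sum[OF I] prod.distrib[symmetric]
      by (intro prod.cong refl normal_density_shift \<sigma>)
    also have "\<dots> = K Y * (\<Prod>x\<in>I. g Y x (th x))"
      unfolding * exp_sum[OF I] g_def ..
    finally show ?thesis .
  qed
  note c = gaussian_conjugacy[OF \<sigma> s]
  define G where "G = (\<lambda>Y. \<Prod>x\<in>I. \<integral>t. g Y x t \<partial>?N x)"
  have G: "G Y > 0" for Y
    unfolding G_def g_def by (intro prod_pos ballI c(2))
  have LikI: "(\<integral>th. Lik th Y \<partial>Pr) = K Y * G Y" for Y
    unfolding Lik Pr_def G_def integral_mult_right_zero
    by (subst integral_PiM_prod[OF I p]) (auto simp: g_def intro!: c)
  have num: "has_bochner_integral Pr (\<lambda>th. (\<Sum>x\<in>I. (th x - th0 x)\<^sup>2) * Lik th Y) (K Y * (R Y * G Y))" for Y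
  proof -
    have "has_bochner_integral Pr (\<lambda>th. (th x - th0 x)\<^sup>2 * (\<Prod>y\<in>I. g Y y (th y)))
        ((\<rho> x * \<sigma>\<^sup>2 + (\<rho> x * Z Y x - th0 x)\<^sup>2) * G Y)" if x: "x \<in> I" for x
    proof -
      \<comment> \<open>The squared deviation is inserted as an extra factor at index
        \<open>x\<close>, which keeps the integrand a product; all other indices contribute their
        total mass to \<open>G Y\<close>.\<close>
      let ?h = "\<lambda>y t. (if y = x then (t - th0 x)\<^sup>2 else 1) * g Y y t"
      have h: "integrable (?N y) (?h y)" if "y \<in> I" for y
        using c(1,3)[OF that] by (cases "y = x") (auto simp: g_def)
      have "(\<lambda>th. \<Prod>y\<in>I. ?h y (th y)) = (\<lambda>th. (th x - th0 x)\<^sup>2 * (\<Prod>y\<in>I. g Y y (th y)))"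
        using x I by (simp add: prod.distrib prod.delta)
      moreover have "(\<Prod>y\<in>I. \<integral>t. ?h y t \<partial>?N y)
          = (\<Prod>y\<in>I. (if y = x then \<rho> x * \<sigma>\<^sup>2 + (\<rho> x * Z Y x - th0 x)\<^sup>2 else 1) * (\<integral>t. g Y y t \<partial>?N y))"
        by (intro prod.cong) (auto simp: c(4) g_def \<rho>_def)
      moreover have "\<dots> = (\<rho> x * \<sigma>\<^sup>2 + (\<rho> x * Z Y x - th0 x)\<^sup>2) * G Y"
        using x I by (simp add: prod.distrib prod.delta G_def)
      ultimately show ?thesis
        unfolding Pr_def has_bochner_integral_iff
        using integrable_PiM_prod[of I ?N ?h, OF I p h] integral_PiM_prod[of I ?N ?h, OF I p h] by simp
    qed
    then have "has_bochner_integral Pr (\<lambda>th. K Y * (\<Sum>x\<in>I. (th x - th0 x)\<^sup>2 * (\<Prod>y\<in>I. g Y y (th y))))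
        (K Y * (\<Sum>x\<in>I. (\<rho> x * \<sigma>\<^sup>2 + (\<rho> x * Z Y x - th0 x)\<^sup>2) * G Y))"
      by (intro has_bochner_integral_mult_right has_bochner_integral_sum)
    then show ?thesis
      unfolding Lik R_def by (simp add: sum_distrib_right sum_distrib_left mult_ac)
  qed
  have Lpos: "Lik th Y \<ge> 0" for th Y unfolding Lik_def by (intro prod_nonneg) simp
  have Post0: "0 \<le> Post Y" for Y
    unfolding Post_def by (intro divide_nonneg_nonneg Bochner_Integration.integral_nonneg) (auto simp: Lpos)
  have Post: "Post Y \<le> R Y / \<delta>" for Y
  proof -
    note ni = num[of Y, unfolded has_bochner_integral_iff]
    \<comment> \<open>Markov's inequality for an arbitrary set \<open>B\<close>:
      \<open>integral_mono'\<close> asks for integrability of the upper bound only, because a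
      non-integrable integrand has integral 0 by convention.\<close>
    have "(\<integral>th. indicator B th * Lik th Y \<partial>Pr) \<le> (\<integral>th. (\<Sum>x\<in>I. (th x - th0 x)\<^sup>2) * Lik th Y / \<delta> \<partial>Pr)"
    proof (rule integral_mono')
      show "integrable Pr (\<lambda>th. (\<Sum>x\<in>I. (th x - th0 x)\<^sup>2) * Lik th Y / \<delta>)" using ni by simp
      show "0 \<le> (\<Sum>x\<in>I. (th x - th0 x)\<^sup>2) * Lik th Y / \<delta>" for th
        using \<delta> Lpos by (simp add: sum_nonneg)
      show "indicator B th * Lik th Y \<le> (\<Sum>x\<in>I. (th x - th0 x)\<^sup>2) * Lik th Y / \<delta>" for th
      proof (cases "th \<in> B")
        case True
        then have "\<delta> * Lik th Y \<le> (\<Sum>x\<in>I. (th x - th0 x)\<^sup>2) * Lik th Y"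
          using B Lpos by (intro mult_right_mono) auto
        then show ?thesis using True \<delta> by (simp add: field_simps)
      qed (use \<delta> Lpos in \<open>simp add: sum_nonneg\<close>)
    qed
    also have "\<dots> = K Y * (R Y * G Y) / \<delta>" using ni by simp
    finally have "Post Y \<le> (K Y * (R Y * G Y) / \<delta>) / (K Y * G Y)"
      unfolding Post_def LikI using K[of Y] G[of Y] by (intro divide_right_mono) auto
    then show ?thesis using K[of Y] G[of Y] by simp
  qed
  have R: "has_bochner_integral ?D R (\<Sum>x\<in>I. \<rho> x * \<sigma>\<^sup>2 + ((\<rho> x)\<^sup>2 * \<sigma>\<^sup>2 + (1 - \<rho> x)\<^sup>2 * (th0 x)\<^sup>2))"
  proof -
    have "has_bochner_integral ?D (\<lambda>Y. (\<rho> x * Z Y x - th0 x)\<^sup>2) ((\<rho> x)\<^sup>2 * \<sigma>\<^sup>2 + (1 - \<rho> x)\<^sup>2 * (th0 x)\<^sup>2)"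
      if x: "x \<in> I" for x
    proof -
      have "(\<Sum>z\<in>I. \<rho> x * b x z * (Y z - f th0 z)) = \<rho> x * (Z Y x - Z (f th0) x)" for Y
        unfolding Z_def by (simp add: sum_distrib_left sum_subtractf right_diff_distrib mult_ac)
      \<comment> \<open>Bias-variance decomposition: the error of the posterior mean is a linear
        form in the centred noise plus the shrinkage bias
        \<open>(\<rho> x - 1) * th0 x\<close>.\<close>
      then have 1: "(\<Sum>z\<in>I. \<rho> x * b x z * (Y z - f th0 z)) + (\<rho> x - 1) * th0 x = \<rho> x * Z Y x - th0 x" for Y
        using x by (simp add: Zf algebra_simps)
      have "(\<Sum>z\<in>I. (\<rho> x * b x z)\<^sup>2) = (\<rho> x)\<^sup>2 * (\<Sum>z\<in>I. b x z * b x z)"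
        by (simp add: sum_distrib_left power2_eq_square mult_ac)
      then have 2: "\<sigma>\<^sup>2 * (\<Sum>z\<in>I. (\<rho> x * b x z)\<^sup>2) + ((\<rho> x - 1) * th0 x)\<^sup>2
          = (\<rho> x)\<^sup>2 * \<sigma>\<^sup>2 + (1 - \<rho> x)\<^sup>2 * (th0 x)\<^sup>2"
        using x by (simp add: orth power_mult_distrib power2_commute[of 1])
      show ?thesis
        using PiM_normal_linear_form[OF I \<sigma>, of "f th0" "\<lambda>z. \<rho> x * b x z" "(\<rho> x - 1) * th0 x"]
        unfolding 1 2 .
    qed
    then show ?thesis
      unfolding R_def
      by (intro has_bochner_integral_sum has_bochner_integral_add)
         (auto simp: has_bochner_integral_iff D.prob_space)
  qed
  note Ri = R[unfolded has_bochner_integral_iff]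
  show "0 \<le> (\<integral>Y. Post Y \<partial>?D)" by (intro Bochner_Integration.integral_nonneg) (auto simp: Post0)
  have "(\<integral>Y. Post Y \<partial>?D) \<le> (\<integral>Y. R Y / \<delta> \<partial>?D)"
    using Ri Post order_trans[OF Post0 Post] by (intro integral_mono') auto
  also have "\<dots> = (\<Sum>x\<in>I. \<rho> x * \<sigma>\<^sup>2 + ((\<rho> x)\<^sup>2 * \<sigma>\<^sup>2 + (1 - \<rho> x)\<^sup>2 * (th0 x)\<^sup>2)) / \<delta>"
    using Ri by simp
  finally show "(\<integral>Y. Post Y \<partial>?D) \<le> (\<Sum>x\<in>I. shrink \<sigma> (s x) * \<sigma>\<^sup>2 + (shrink \<sigma> (s x))\<^sup>2 * \<sigma>\<^sup>2
               + (1 - shrink \<sigma> (s x))\<^sup>2 * (th0 x)\<^sup>2) / \<delta>"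
    by (simp add: \<rho>_def add.assoc)
qed

section \<open>Sums of truncated powers and bounds on the shrinkage factor\<close>

text \<open>The mean value theorem for \<open>t powr (1 - p)\<close> on a unit interval: the local
  form of comparing a sum with an integral.\<close>

lemma powr_neg_le_telescope:
  fixes x p :: real
  assumes "x > 0" "p > 1"
  shows "(x + 1) powr (- p) \<le> (x powr (1 - p) - (x + 1) powr (1 - p)) / (p - 1)"
proof -
  have "\<exists>z. x < z \<and> z < x + 1 \<and>
      (x + 1) powr (1 - p) - x powr (1 - p) = (x + 1 - x) * ((1 - p) * z powr (1 - p - 1))"
    using assms by (intro MVT2) (auto intro!: derivative_eq_intros)
  then obtain z where z: "x < z" "z < x + 1"
    "(x + 1) powr (1 - p) - x powr (1 - p) = (1 - p) * z powr (- p)" by auto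
  then have "(x powr (1 - p) - (x + 1) powr (1 - p)) / (p - 1) = z powr (- p)"
    using assms by (simp add: field_simps)
  then show ?thesis using z assms by (auto intro!: powr_mono2')
qed

text \<open>Up to the factor \<open>2 powr p\<close>, the summand is at most \<open>(a / (a + m)) powr p\<close>, which telescopes
  without a boundary term.\<close>
lemma sum_min_powr_le:
  fixes a p :: real
  assumes a: "a > 0" and p: "p > 1"
  shows "(\<Sum>m=1..n. min 1 ((a / real m) powr p)) \<le> 2 powr p / (p - 1) * a"
proof -
  have bound: "min 1 ((a / real m) powr p) \<le> 2 powr p * a powr p * (a + real m) powr (- p)"
    if "m \<ge> 1" for m
  proof -
    have m: "real m > 0" using that by simp
    have eq: "2 powr p * a powr p * (a + real m) powr (- p) = (2 * a / (a + real m)) powr p"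
      using a m by (simp add: powr_divide powr_mult powr_minus_divide)
    show ?thesis
    \<comment> \<open>The ratio \<open>2 * a / (a + m)\<close> dominates both branches of the
      minimum: it is at least 1 for \<open>m \<le> a\<close> and at least \<open>a / m\<close> for
      \<open>m > a\<close>.\<close>
    proof (cases "a \<ge> real m")
      case True
      then have "1 \<le> 2 * a / (a + real m)" using a m by (simp add: field_simps)
      then have "1 \<le> (2 * a / (a + real m)) powr p" using p by (simp add: ge_one_powr_ge_zero)
      then show ?thesis unfolding eq by simp
    next
      case False
      then have "a / real m \<le> 2 * a / (a + real m)" using a m by (simp add: field_simps)
      then have "(a / real m) powr p \<le> (2 * a / (a + real m)) powr p"
        using a m p by (intro powr_mono2) auto
      then show ?thesis unfolding eq by simp
    qed
  qed
  have tel: "(\<Sum>m=1..n. (a + real m) powr (- p)) \<le> (a powr (1 - p) - (a + real n) powr (1 - p)) / (p - 1)"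
  proof (induction n)
    case (Suc n)
    show ?case using powr_neg_le_telescope[of "a + real n" p] Suc a p
      by (simp add: diff_divide_distrib algebra_simps)
  qed simp
  have "(\<Sum>m=1..n. min 1 ((a / real m) powr p)) \<le> (\<Sum>m=1..n. 2 powr p * a powr p * (a + real m) powr (- p))"
    by (intro sum_mono bound) auto
  also have "\<dots> = 2 powr p * a powr p * (\<Sum>m=1..n. (a + real m) powr (- p))"
    by (simp add: sum_distrib_left)
  also have "\<dots> \<le> 2 powr p * a powr p * ((a powr (1 - p) - (a + real n) powr (1 - p)) / (p - 1))"
    by (intro mult_left_mono tel) auto
  also have "\<dots> \<le> 2 powr p * a powr p * (a powr (1 - p) / (p - 1))"
    using p by (intro mult_left_mono divide_right_mono) auto
  also have "\<dots> = 2 powr p / (p - 1) * (a powr p * a powr (1 - p))" by simp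
  also have "a powr p * a powr (1 - p) = a" using a by (simp flip: powr_add)
  finally show ?thesis .
qed

text \<open>For fixed \<open>m\<close> the inner sum is truncated at the \<open>j\<close> where the
  product of powers reaches 1, and its size is of the order of that point. What remains is a power
  sum with exponent \<open>p / q\<close>, whose growth separates the three regimes.\<close>

lemma double_sum_min_powr_le:
  fixes A p q :: real
  assumes A: "A > 0" and q: "q > 1"
  shows "(\<Sum>m=1..n. \<Sum>j=1..k. min 1 (A * real m powr (- p) * real j powr (- q)))
      \<le> 2 powr q / (q - 1) * A powr (1 / q) * (\<Sum>m=1..n. real m powr (- p / q))"
proof -
  have "(\<Sum>j=1..k. min 1 (A * real m powr (- p) * real j powr (- q)))
      \<le> 2 powr q / (q - 1) * (A powr (1 / q) * real m powr (- p / q))" if m: "m \<ge> 1" for m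
  proof -
    define a where "a = A powr (1 / q) * real m powr (- p / q)"
    have a: "a > 0" using A m by (simp add: a_def)
    have "min 1 (A * real m powr (- p) * real j powr (- q)) = min 1 ((a / real j) powr q)" if "j \<ge> 1" for j
      using that A q m by (simp add: a_def powr_divide powr_mult powr_powr powr_minus_divide)
    then show ?thesis using sum_min_powr_le[OF a q, of k] by (simp add: a_def)
  qed
  then have "(\<Sum>m=1..n. \<Sum>j=1..k. min 1 (A * real m powr (- p) * real j powr (- q)))
      \<le> (\<Sum>m=1..n. 2 powr q / (q - 1) * (A powr (1 / q) * real m powr (- p / q)))"
    by (intro sum_mono) auto
  then show ?thesis by (simp only: sum_distrib_left mult.assoc)
qed

text \<open>The truncated sum with \<open>a = 1\<close>, where the truncation at 1 is inactive
  because every \<open>m\<close> is at least 1.\<close>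

lemma sum_powr_bounded:
  fixes p :: real
  assumes "p > 1"
  obtains C where "C > 0" "\<And>n. (\<Sum>m=1..n. real m powr (- p)) \<le> C"
proof
  have "(\<Sum>m=1..n. real m powr (- p)) \<le> 2 powr p / (p - 1)" for n
  proof -
    have "(\<Sum>m=1..n. real m powr (- p)) = (\<Sum>m=1..n. min 1 ((1 / real m) powr p))"
      using assms by (intro sum.cong) (auto simp: powr_divide powr_minus_divide ge_one_powr_ge_zero)
    then show ?thesis using sum_min_powr_le[of 1 p n] assms by simp
  qed
  then show "\<And>n. (\<Sum>m=1..n. real m powr (- p)) \<le> 2 powr p / (p - 1)" .
  show "2 powr p / (p - 1) > 0" using assms by simp
qed

text \<open>The difference between harmonic number and logarithm is decreasing and starts at
  1.\<close>

lemma harmonic_sum_le: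
  assumes "n \<ge> 1"
  shows "(\<Sum>m=1..n. real m powr (-1)) \<le> 1 + ln (real n)"
proof -
  obtain k where k: "n = Suc k" using assms by (cases n) auto
  have "harm (Suc k) - ln (real (Suc k)) \<le> harm (Suc 0) - ln (real (Suc 0))"
    using decseqD[OF decseq_harm_diff_ln, of 0 k] by simp
  moreover have "(\<Sum>m=1..n. real m powr (-1)) = harm n"
    unfolding harm_def by (intro sum.cong) (auto simp: powr_minus)
  ultimately show ?thesis by (simp add: k harm_def)
qed

text \<open>With \<open>v\<close> the prior variance, both variance contributions are at most
  \<open>v\<close> and at most \<open>\<sigma>\<^sup>2\<close>. The squared bias factor is of order
  \<open>min 1 (1 / v)\<close>, which lies below \<open>v powr (- a)\<close> for every
  \<open>a\<close> between 0 and 1; the exponent stays free so that it can be fitted to the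
  smoothness condition.\<close>

lemma shrinkage_bounds:
  fixes \<sigma> v a :: real
  assumes \<sigma>: "\<sigma> > 0" and v: "v > 0" and a: "0 \<le> a" "a \<le> 1"
  defines "\<rho> \<equiv> v / (v + \<sigma>\<^sup>2)"
  shows "\<rho> * \<sigma>\<^sup>2 + \<rho>\<^sup>2 * \<sigma>\<^sup>2 \<le> 2 * (1 + \<sigma>\<^sup>2) * min 1 v"
    and "(1 - \<rho>)\<^sup>2 \<le> (1 + \<sigma>\<^sup>2) * v powr (- a)"
proof -
  have d: "v + \<sigma>\<^sup>2 > 0" using v by (simp add: add_pos_nonneg)
  have \<rho>: "0 \<le> \<rho>" "\<rho> \<le> 1" using v d by (auto simp: \<rho>_def)
  have "\<rho> * \<sigma>\<^sup>2 \<le> v" using v d by (simp add: \<rho>_def field_simps)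
  moreover have "\<rho> * \<sigma>\<^sup>2 \<le> \<sigma>\<^sup>2" using \<rho> by (simp add: mult_left_le_one_le)
  moreover have "v \<le> (1 + \<sigma>\<^sup>2) * v" using v by (simp add: algebra_simps)
  ultimately have 1: "\<rho> * \<sigma>\<^sup>2 \<le> (1 + \<sigma>\<^sup>2) * min 1 v" by (auto simp: min_def)
  have "\<rho>\<^sup>2 * \<sigma>\<^sup>2 \<le> \<rho> * \<sigma>\<^sup>2"
    using \<rho> by (intro mult_right_mono) (auto simp: power2_eq_square mult_left_le)
  then show "\<rho> * \<sigma>\<^sup>2 + \<rho>\<^sup>2 * \<sigma>\<^sup>2 \<le> 2 * (1 + \<sigma>\<^sup>2) * min 1 v" using 1 by linarith
  have e: "1 - \<rho> = \<sigma>\<^sup>2 / (v + \<sigma>\<^sup>2)" using d by (simp add: \<rho>_def field_simps)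
  \<comment> \<open>A single factor \<open>1 - \<rho>\<close> already decays like
    \<open>1 / v\<close>, which is enough for every exponent up to 1.\<close>
  have "(1 - \<rho>)\<^sup>2 \<le> 1 - \<rho>" using \<rho> by (simp add: power2_eq_square mult_left_le)
  also have "\<dots> \<le> (1 + \<sigma>\<^sup>2) * min 1 (1 / v)"
  proof -
    have "1 - \<rho> \<le> \<sigma>\<^sup>2 * (1 / v)" unfolding e using v d by (simp add: field_simps)
    also have "\<dots> \<le> (1 + \<sigma>\<^sup>2) * (1 / v)" using v by (intro mult_right_mono) auto
    finally have "1 - \<rho> \<le> (1 + \<sigma>\<^sup>2) * (1 / v)" .
    moreover have "1 - \<rho> \<le> 1 + \<sigma>\<^sup>2" using \<rho> by (simp add: add_increasing2)
    ultimately show ?thesis by (auto simp: min_def)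
  qed
  finally have *: "(1 - \<rho>)\<^sup>2 \<le> (1 + \<sigma>\<^sup>2) * min 1 (1 / v)" .
  have "min 1 (1 / v) \<le> v powr (- a)"
  proof (cases "v \<ge> 1")
    case True
    then have "v powr (-1) \<le> v powr (- a)" using a by (intro powr_mono) auto
    then show ?thesis using v by (simp add: powr_minus_divide)
  next
    case False
    then have "v powr a \<le> 1" using v a by (intro powr_le1) auto
    then have "1 \<le> v powr (- a)" using v by (simp add: powr_minus_divide)
    then show ?thesis by simp
  qed
  then have "(1 + \<sigma>\<^sup>2) * min 1 (1 / v) \<le> (1 + \<sigma>\<^sup>2) * v powr (- a)"
    by (intro mult_left_mono) auto
  with * show "(1 - \<rho>)\<^sup>2 \<le> (1 + \<sigma>\<^sup>2) * v powr (- a)" by linarith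
qed

section \<open>Linear interpolation error\<close>

text \<open>Merges the branches of \<open>lin_interp\<close>. Nodes and weight depend on
  \<open>t\<close> and \<open>T\<close> alone, so one choice serves all value vectors
  \<open>v\<close>; in the two end branches the nodes coincide and the weight is 0.\<close>

lemma lin_interp_convex_combination:
  assumes T: "T \<ge> 1" and t: "t \<in> {0..1}"
  obtains k l w where "k \<in> {1..T}" "l \<in> {1..T}" "\<bar>t * real T - real k\<bar> \<le> 1" "\<bar>t * real T - real l\<bar> \<le> 1"
    "0 \<le> w" "w \<le> 1" "\<And>v. lin_interp T v t = (1 - w) * v k + w * v l"
proof -
  have tT: "0 \<le> t * real T" "t * real T \<le> real T"
    using t T by (auto simp: mult_left_le_one_le)
  consider (left) "t \<le> 1 / real T" | (right) "t > 1 / real T" "T \<le> nat \<lfloor>t * real T\<rfloor>"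
    | (mid) "t > 1 / real T" "nat \<lfloor>t * real T\<rfloor> < T" by linarith
  then show ?thesis
  proof cases
    case left
    then have "t * real T \<le> 1" using T by (simp add: field_simps)
    then show ?thesis using left T tT by (intro that[of 1 1 0]) (auto simp: lin_interp_def)
  next
    case right
    then have "t * real T = real T" using tT by linarith
    then show ?thesis using right T by (intro that[of T T 0]) (auto simp: lin_interp_def)
  next
    case mid
    define k where "k = nat \<lfloor>t * real T\<rfloor>"
    have "t * real T > 1" using mid T by (simp add: field_simps)
    then have k: "k \<ge> 1" "real k \<le> t * real T" "t * real T < real k + 1"
      unfolding k_def by linarith+
    have "lin_interp T v t = (1 - (t * real T - real k)) * v k + (t * real T - real k) * v (Suc k)" for v
      using mid by (simp add: lin_interp_def k_def[symmetric] Let_def algebra_simps)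
    then show ?thesis using k mid(2)
      by (intro that[of k "Suc k" "t * real T - real k"]) (auto simp: k_def[symmetric])
  qed
qed

text \<open>The error is a convex combination \<open>X\<close> of errors at the nodes plus one,
  \<open>E\<close>, of increments of \<open>F\<close> over at most one grid step. The sum over all
  \<open>k\<close> with windows replaces the nodes, which vary with \<open>t\<close>, by a step
  function of \<open>t\<close> that is easy to integrate.\<close>

lemma lin_interp_error_sq_le:
  fixes v F L
  assumes T: "T \<ge> 1" and t: "t \<in> {0..1}"
    and Lip: "\<And>s t. s \<in> {0..1} \<Longrightarrow> t \<in> {0..1} \<Longrightarrow> \<bar>F s - F t\<bar> \<le> L * \<bar>s - t\<bar>"
  shows "\<bar>lin_interp T v t - F t\<bar>\<^sup>2
      \<le> (\<Sum>k=1..T. if t \<in> {(real k - 1) / real T..(real k + 1) / real T}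
            then 2 * (v k - F (real k / real T))\<^sup>2 else 0) + 2 * (L / real T)\<^sup>2"
proof -
  define d where "d k = v k - F (real k / real T)" for k
  define S where "S = (\<Sum>k=1..T. if t \<in> {(real k - 1) / real T..(real k + 1) / real T} then 2 * (d k)\<^sup>2 else 0)"
  obtain k l w where kl: "k \<in> {1..T}" "l \<in> {1..T}" "\<bar>t * real T - real k\<bar> \<le> 1" "\<bar>t * real T - real l\<bar> \<le> 1"
    and w: "0 \<le> w" "w \<le> 1" and eq: "\<And>v. lin_interp T v t = (1 - w) * v k + w * v l"
    using lin_interp_convex_combination[OF T t] by metis
  have near_value: "2 * (d m)\<^sup>2 \<le> S" if "m \<in> {1..T}" "\<bar>t * real T - real m\<bar> \<le> 1" for m
  proof -
    have "t \<in> {(real m - 1) / real T..(real m + 1) / real T}"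
      using that T by (auto simp: field_simps abs_le_iff)
    then have "2 * (d m)\<^sup>2 = (if t \<in> {(real m - 1) / real T..(real m + 1) / real T} then 2 * (d m)\<^sup>2 else 0)"
      by simp
    also have "\<dots> \<le> S" unfolding S_def using that(1) by (intro member_le_sum) auto
    finally show ?thesis .
  qed
  have near_truth: "\<bar>F (real m / real T) - F t\<bar> \<le> L / real T"
    if "m \<in> {1..T}" "\<bar>t * real T - real m\<bar> \<le> 1" for m
  proof -
    have m: "real m / real T \<in> {0..1}" using that T by auto
    have L0: "0 \<le> L" using Lip[of 0 1] by (auto simp: order_trans[OF abs_ge_zero])
    have "\<bar>real m / real T - t\<bar> \<le> 1 / real T" using that(2) T by (simp add: field_simps abs_le_iff)
    then have "L * \<bar>real m / real T - t\<bar> \<le> L * (1 / real T)" using L0 by (rule mult_left_mono)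
    then show ?thesis using Lip[OF m t] by simp
  qed
  define X where "X = (1 - w) * d k + w * d l"
  define E where "E = (1 - w) * (F (real k / real T) - F t) + w * (F (real l / real T) - F t)"
  have dec: "lin_interp T v t - F t = X + E"
    unfolding eq X_def E_def d_def by (simp add: algebra_simps)
  have sq: "((1 - w) * a + w * b)\<^sup>2 \<le> (1 - w) * a\<^sup>2 + w * b\<^sup>2" for a b :: real
  proof -
    have "(1 - w) * a\<^sup>2 + w * b\<^sup>2 - ((1 - w) * a + w * b)\<^sup>2 = w * (1 - w) * (a - b)\<^sup>2"
      by (simp add: power2_eq_square algebra_simps)
    moreover have "\<dots> \<ge> 0" using w by simp
    ultimately show ?thesis by linarith
  qed
  have cvx: "((1 - w) * a + w * b)\<^sup>2 \<le> u" if "a\<^sup>2 \<le> u" "b\<^sup>2 \<le> u" for a b u :: real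
  proof -
    have "(1 - w) * a\<^sup>2 + w * b\<^sup>2 \<le> (1 - w) * u + w * u"
      using that w by (intro add_mono mult_left_mono) auto
    then show ?thesis using sq[of a b] by (simp add: algebra_simps)
  qed
  have X: "X\<^sup>2 \<le> S / 2" unfolding X_def using near_value kl by (intro cvx) force+
  have "E\<^sup>2 \<le> (L / real T)\<^sup>2" unfolding E_def using near_truth kl
    by (intro cvx abs_le_square_iff[THEN iffD1] order_trans[OF _ abs_ge_self]) auto
  moreover have "(X + E)\<^sup>2 \<le> 2 * X\<^sup>2 + 2 * E\<^sup>2"
    using zero_le_power2[of "X - E"] by (simp add: power2_sum power2_diff)
  ultimately show ?thesis using X unfolding dec power2_abs S_def d_def by linarith
qed

text \<open>Only an upper bound, because the window may stick out of the unit interval, as it does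
  at the last grid point.\<close>

lemma integral_if_interval_le:
  fixes a b c :: real
  assumes "a \<le> b" "c \<ge> 0"
  shows "(\<lambda>t. if t \<in> {a..b} then c else 0) integrable_on {0..1}"
    and "integral {0..1} (\<lambda>t. if t \<in> {a..b} then c else 0) \<le> c * (b - a)"
proof -
  have "(\<lambda>_. c) integrable_on ({a..b} \<inter> {0..1})"
    by (simp add: integrable_const_ivl)
  then show "(\<lambda>t. if t \<in> {a..b} then c else 0) integrable_on {0..1}"
    using integrable_restrict_Int[of "{a..b}" "\<lambda>_. c" "{0..1}"] by simp
  have "integral {0..1} (\<lambda>t. if t \<in> {a..b} then c else 0) = integral ({a..b} \<inter> {0..1}) (\<lambda>_. c)"
    by (rule integral_restrict_Int)
  also have "\<dots> = c * measure lborel {max a 0..min b 1}" by (simp add: mult.commute)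
  also have "\<dots> \<le> c * (b - a)"
    using assms by (intro mult_left_mono) (auto simp: content_real_if)
  finally show "integral {0..1} (\<lambda>t. if t \<in> {a..b} then c else 0) \<le> c * (b - a)" .
qed

text \<open>Integrates the pointwise bound: each window has length \<open>2 / T\<close>, and the
  factor 2 in front of the squared node error makes this \<open>4 / T\<close>.\<close>

lemma integral_lin_interp_error_le:
  fixes v F L
  assumes T: "T \<ge> 1"
    and Lip: "\<And>s t. s \<in> {0..1} \<Longrightarrow> t \<in> {0..1} \<Longrightarrow> \<bar>F s - F t\<bar> \<le> L * \<bar>s - t\<bar>"
  shows "integral {0..1} (\<lambda>t. \<bar>lin_interp T v t - F t\<bar>\<^sup>2)
      \<le> 4 / real T * (\<Sum>k=1..T. (v k - F (real k / real T))\<^sup>2) + 2 * (L / real T)\<^sup>2"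
    (is "integral _ ?f \<le> ?R")
\<comment> \<open>The split spares a proof of integrability: the integral of a non-integrable
  function is 0, and the right-hand side is nonnegative.\<close>
proof (cases "?f integrable_on {0..1}")
  case True
  let ?g = "\<lambda>k t. if t \<in> {(real k - 1) / real T..(real k + 1) / real T}
            then 2 * (v k - F (real k / real T))\<^sup>2 else 0"
  have le: "(real k - 1) / real T \<le> (real k + 1) / real T" for k
    by (intro divide_right_mono) auto
  have g: "?g k integrable_on {0..1}"
    "integral {0..1} (?g k) \<le> 4 / real T * (v k - F (real k / real T))\<^sup>2" for k
    using integral_if_interval_le[OF le[of k], of "2 * (v k - F (real k / real T))\<^sup>2"]
    using T by (auto simp flip: diff_divide_distrib)
  have sg: "(\<lambda>t. \<Sum>k=1..T. ?g k t) integrable_on {0..1}" using g by (intro integrable_sum) auto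
  have "integral {0..1} ?f \<le> integral {0..1} (\<lambda>t. (\<Sum>k=1..T. ?g k t) + 2 * (L / real T)\<^sup>2)"
    using lin_interp_error_sq_le[OF T _ Lip] sg
    by (intro integral_le True integrable_add integrable_const_ivl) auto
  also have "\<dots> = (\<Sum>k=1..T. integral {0..1} (?g k)) + 2 * (L / real T)\<^sup>2"
    using sg g by (subst Henstock_Kurzweil_Integration.integral_add)
      (auto simp: Henstock_Kurzweil_Integration.integral_sum intro: integrable_const_ivl)
  also have "\<dots> \<le> (\<Sum>k=1..T. 4 / real T * (v k - F (real k / real T))\<^sup>2) + 2 * (L / real T)\<^sup>2"
    by (intro add_mono sum_mono g) auto
  finally show ?thesis by (simp add: sum_distrib_left)
next
  case False
  then show ?thesis by (simp add: not_integrable_integral sum_nonneg)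
qed

lemma dL2_lin_interp_le:
  fixes n T :: nat and v fs F L
  assumes n: "n \<ge> 1" and T: "T \<ge> 1" and L: "L \<ge> 0"
    and Lip: "\<And>i s t. i \<in> {1..n} \<Longrightarrow> s \<in> {0..1} \<Longrightarrow> t \<in> {0..1} \<Longrightarrow> \<bar>F i s - F i t\<bar> \<le> L * \<bar>s - t\<bar>"
    and grid: "\<And>i k. i \<in> {1..n} \<Longrightarrow> k \<in> {1..T} \<Longrightarrow> F i (real k / real T) = fs i k"
  shows "dL2 n (\<lambda>i. lin_interp T (v i)) F \<le> 2 * dn n T v fs + 2 * L * (1 / real T)"
proof -
  let ?S = "\<Sum>i=1..n. \<Sum>k=1..T. \<bar>v i k - fs i k\<bar>\<^sup>2"
  have "(\<Sum>i=1..n. integral {0..1} (\<lambda>t. \<bar>lin_interp T (v i) t - F i t\<bar>\<^sup>2))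
     \<le> (\<Sum>i=1..n. 4 / real T * (\<Sum>k=1..T. (v i k - F i (real k / real T))\<^sup>2) + 2 * (L / real T)\<^sup>2)"
    by (intro sum_mono integral_lin_interp_error_le T Lip)
  also have "\<dots> = (\<Sum>i=1..n. 4 / real T * (\<Sum>k=1..T. \<bar>v i k - fs i k\<bar>\<^sup>2) + 2 * (L / real T)\<^sup>2)"
    by (intro sum.cong refl arg_cong2[of _ _ _ _ "(+)"] arg_cong2[of _ _ _ _ "(*)"]) (simp_all add: grid)
  also have "\<dots> = 4 / real T * ?S + real n * (2 * (L / real T)\<^sup>2)"
    by (simp add: sum.distrib sum_distrib_left)
  finally have "1 / real n * (\<Sum>i=1..n. integral {0..1} (\<lambda>t. \<bar>lin_interp T (v i) t - F i t\<bar>\<^sup>2))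
      \<le> 1 / real n * (4 / real T * ?S + real n * (2 * (L / real T)\<^sup>2))"
    by (intro mult_left_mono) auto
  also have "\<dots> = 4 * (1 / (real n * real T) * ?S) + 2 * (L / real T)\<^sup>2"
    using n T by (simp add: field_simps)
  also have "1 / (real n * real T) * ?S = (dn n T v fs)\<^sup>2"
    unfolding dn_def by (simp add: sum_nonneg)
  \<comment> \<open>Completing to a full square adds only nonnegative terms, so the square root
    becomes linear in both error sources.\<close>
  also have "4 * (dn n T v fs)\<^sup>2 + 2 * (L / real T)\<^sup>2 \<le> (2 * dn n T v fs + 2 * L * (1 / real T))\<^sup>2"
  proof -
    have "0 \<le> dn n T v fs * (L / real T)" using L by (simp add: dn_def sum_nonneg)
    moreover have "(2 * dn n T v fs + 2 * L * (1 / real T))\<^sup>2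
        = 4 * (dn n T v fs)\<^sup>2 + 8 * (dn n T v fs * (L / real T)) + 4 * (L / real T)\<^sup>2"
      by (simp add: power2_eq_square algebra_simps)
    ultimately show ?thesis using zero_le_power2[of "L / real T"] by linarith
  qed
  finally show ?thesis
    unfolding dL2_def using L by (intro real_le_lsqrt) (auto simp: dn_def sum_nonneg)
qed

section \<open>Orthonormal coordinates of the trend\<close>

lemma ftrend_eq_sum: "ftrend n T e psi th i k = (\<Sum>x\<in>Iset n T. th x * (e (fst x) i * psi (snd x) k))"
  unfolding ftrend_def Iset_def by (simp add: sum.cartesian_product split_def mult.assoc)

lemma orthonormal_tensor:
  assumes e: "\<forall>m\<in>{1..n}. \<forall>m'\<in>{1..n}. (\<Sum>i=1..n. e m i * e m' i) = (if m = m' then 1 else 0)"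
    and psi: "orthogonal_basis_matrix T psi" and xy: "x \<in> Iset n T" "y \<in> Iset n T"
  shows "(\<Sum>z\<in>Iset n T. (e (fst x) (fst z) * psi (snd x) (snd z)) * (e (fst y) (fst z) * psi (snd y) (snd z)))
      = (if x = y then 1 else 0 :: real)"
proof -
  have "(\<Sum>z\<in>Iset n T. (e (fst x) (fst z) * psi (snd x) (snd z)) * (e (fst y) (fst z) * psi (snd y) (snd z)))
      = (\<Sum>i=1..n. e (fst x) i * e (fst y) i) * (\<Sum>k=1..T. psi (snd x) k * psi (snd y) k)"
    unfolding Iset_def sum_product sum.cartesian_product by (intro sum.cong) auto
  then show ?thesis
    using e psi xy by (auto simp: Iset_def orthogonal_basis_matrix_def prod_eq_iff)
qed

text \<open>Parseval's identity for the expansion in the system \<open>b\<close>.\<close>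

lemma sum_sq_orthonormal:
  fixes b :: "'i \<Rightarrow> 'i \<Rightarrow> real"
  assumes I: "finite I" and orth: "\<And>x y. x \<in> I \<Longrightarrow> y \<in> I \<Longrightarrow> (\<Sum>z\<in>I. b x z * b y z) = (if x = y then 1 else 0)"
  shows "(\<Sum>z\<in>I. (\<Sum>x\<in>I. d x * b x z)\<^sup>2) = (\<Sum>x\<in>I. (d x)\<^sup>2)"
proof -
  have "(\<Sum>z\<in>I. (\<Sum>x\<in>I. d x * b x z)\<^sup>2) = (\<Sum>z\<in>I. \<Sum>x\<in>I. \<Sum>y\<in>I. (d x * d y) * (b x z * b y z))"
    by (simp add: power2_eq_square sum_product mult_ac)
  also have "\<dots> = (\<Sum>x\<in>I. \<Sum>y\<in>I. (d x * d y) * (\<Sum>z\<in>I. b x z * b y z))"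
    unfolding sum_distrib_left
    by (subst sum.swap, rule sum.cong[OF refl], rule sum.swap)
  also have "\<dots> = (\<Sum>x\<in>I. \<Sum>y\<in>I. if x = y then d x * d y else 0)"
    by (intro sum.cong refl) (simp add: orth)
  finally show ?thesis using I by (simp add: power2_eq_square)
qed

text \<open>Makes \<open>dn\<close> a rescaled Euclidean distance between coefficients, so that tail
  events of the trend become tail events in the sequence model.\<close>

lemma dn_ftrend:
  assumes n: "n \<ge> 1" and T: "T \<ge> 1"
    and e: "\<forall>m\<in>{1..n}. \<forall>m'\<in>{1..n}. (\<Sum>i=1..n. e m i * e m' i) = (if m = m' then 1 else 0)"
    and psi: "orthogonal_basis_matrix T psi"
  shows "real n * real T * (dn n T (ftrend n T e psi th) (ftrend n T e psi th'))\<^sup>2 = (\<Sum>x\<in>Iset n T. (th x - th' x)\<^sup>2)"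
proof -
  let ?b = "\<lambda>x z. e (fst x) (fst z) * psi (snd x) (snd z)"
  have "(\<Sum>i=1..n. \<Sum>k=1..T. \<bar>ftrend n T e psi th i k - ftrend n T e psi th' i k\<bar>\<^sup>2)
      = (\<Sum>z\<in>Iset n T. (\<Sum>x\<in>Iset n T. (th x - th' x) * ?b x z)\<^sup>2)"
    unfolding ftrend_eq_sum sum_subtractf[symmetric] left_diff_distrib[symmetric]
    by (simp add: Iset_def sum.cartesian_product split_def)
  also have "\<dots> = (\<Sum>x\<in>Iset n T. (th x - th' x)\<^sup>2)"
    by (rule sum_sq_orthonormal[OF _ orthonormal_tensor[OF e psi]]) (simp_all add: Iset_def)
  finally show ?thesis using n T unfolding dn_def by (simp add: sum_nonneg)
qed

section \<open>From the sequence model to contraction rates\<close>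

text \<open>The sequence-model bound for the tensor basis. \<open>S\<close> stems from the
  variances, the power of \<open>c\<close> from the bias; after this, only deterministic sums are
  left to estimate.\<close>

lemma posterior_tail_bound:
  fixes n T :: nat and e psi :: "nat \<Rightarrow> nat \<Rightarrow> real" and th0 :: "nat \<times> nat \<Rightarrow> real"
    and \<sigma> c \<beta> \<gamma> r Q \<delta> :: real
  assumes n: "n \<ge> 1" and T: "T \<ge> 1" and pars: "\<sigma> > 0" "c > 0" "\<beta> > 0" "\<gamma> > 0" "r > 0" and \<delta>: "\<delta> > 0"
    and e: "\<forall>m\<in>{1..n}. \<forall>m'\<in>{1..n}. (\<Sum>i=1..n. e m i * e m' i) = (if m = m' then 1 else 0)"
    and psi: "orthogonal_basis_matrix T psi"
    and truth: "(\<Sum>i=1..n. \<Sum>j=1..T. real i powr (2 * \<beta> / r) * real j powr (2 * \<gamma>) * (th0 (i, j))\<^sup>2)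
                  \<le> real n * real T * Q\<^sup>2"
    and B: "B \<subseteq> {th. \<delta> \<le> dn n T (ftrend n T e psi th) (ftrend n T e psi th0)}"
  defines "E \<equiv> \<integral>Y. posterior n T e psi \<sigma> (prior n T c \<beta> \<gamma> r) B Y \<partial>data_law n T (ftrend n T e psi th0) \<sigma>"
    and "S \<equiv> \<Sum>m=1..n. \<Sum>j=1..T. min 1 (c powr (2 * \<beta> / r) * real m powr (- (2 * \<beta> / r)) * real j powr (- (2 * \<gamma> + 1)))"
  shows "0 \<le> E"
    and "E \<le> (1 + \<sigma>\<^sup>2) * (2 * S + c powr (- (4 * \<beta> * \<gamma> / (r * (2 * \<gamma> + 1)))) * (real n * real T * Q\<^sup>2))
               / (real n * real T * \<delta>\<^sup>2)"
proof -
  define I where "I = Iset n T"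
  define p where "p = 2 * \<beta> / r"
  define q where "q = 2 * \<gamma> + 1"
  define a where "a = 2 * \<gamma> / q"
  define b where "b x z = e (fst x) (fst z) * psi (snd x) (snd z)" for x z :: "nat \<times> nat"
  define v where "v x = c powr p * real (fst x) powr (- p) * real (snd x) powr (- q)" for x :: "nat \<times> nat"
  define s where "s x = sqrt (v x)" for x :: "nat \<times> nat"
  have q: "q > 1" and p: "p > 0" and a: "0 \<le> a" "a \<le> 1"
    using pars by (auto simp: q_def p_def a_def)
  have I: "finite I" by (simp add: I_def Iset_def)
  have pos: "real (fst x) \<ge> 1" "real (snd x) \<ge> 1" if "x \<in> I" for x
    using that by (auto simp: I_def Iset_def)
  have v: "v x > 0" if "x \<in> I" for x
    using pos[OF that] pars by (simp add: v_def)
  have s: "s x > 0" "(s x)\<^sup>2 = v x" if "x \<in> I" for x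
    using v[OF that] by (auto simp: s_def)
  have orth: "(\<Sum>z\<in>I. b x z * b y z) = (if x = y then 1 else 0)" if "x \<in> I" "y \<in> I" for x y
    unfolding b_def I_def using orthonormal_tensor[OF e psi, of x y] that by (simp add: I_def)
  have ft: "ftrend n T e psi th (fst z) (snd z) = (\<Sum>x\<in>I. th x * b x z)" for th z
    by (simp add: ftrend_eq_sum b_def I_def)
  have nT: "real n * real T > 0" using n T by simp
  have pr: "prior n T c \<beta> \<gamma> r = PiM I (\<lambda>x. density lborel (normal_density 0 (s x)))"
    unfolding prior_def I_def[symmetric]
  proof (rule PiM_cong)
    fix x assume "x \<in> I"
    then have "(c / real (fst x)) powr (2 * \<beta> / r) * real (snd x) powr (- 2 * \<gamma> - 1) = v x"
      using pos[of x] pars by (simp add: v_def p_def q_def powr_divide powr_minus_divide)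
    then show "(case x of (m, j) \<Rightarrow> density lborel
        (normal_density 0 (sqrt ((c / real m) powr (2 * \<beta> / r) * real j powr (- 2 * \<gamma> - 1)))))
      = density lborel (normal_density 0 (s x))"
      by (simp add: split_def s_def)
  qed simp
  have dl: "data_law n T (ftrend n T e psi th0) \<sigma>
      = PiM I (\<lambda>z. density lborel (normal_density (\<Sum>x\<in>I. th0 x * b x z) \<sigma>))"
    unfolding data_law_def I_def[symmetric] split_def ft ..
  have li: "likelihood n T e psi \<sigma> th Y = (\<Prod>z\<in>I. normal_density (\<Sum>x\<in>I. th x * b x z) \<sigma> (Y z))" for th Y
    unfolding likelihood_def I_def[symmetric] split_def ft by simp
  have B': "B \<subseteq> {th. real n * real T * \<delta>\<^sup>2 \<le> (\<Sum>x\<in>I. (th x - th0 x)\<^sup>2)}"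
  proof
    fix th assume "th \<in> B"
    then have "\<delta> \<le> dn n T (ftrend n T e psi th) (ftrend n T e psi th0)" using B by auto
    then have "\<delta>\<^sup>2 \<le> (dn n T (ftrend n T e psi th) (ftrend n T e psi th0))\<^sup>2"
      using \<delta> by (intro power_mono) auto
    then have "real n * real T * \<delta>\<^sup>2 \<le> real n * real T * (dn n T (ftrend n T e psi th) (ftrend n T e psi th0))\<^sup>2"
      using nT by (intro mult_left_mono) auto
    then show "th \<in> {th. real n * real T * \<delta>\<^sup>2 \<le> (\<Sum>x\<in>I. (th x - th0 x)\<^sup>2)}"
      unfolding dn_ftrend[OF n T e psi] I_def by simp
  qed
  have nd: "real n * real T * \<delta>\<^sup>2 > 0" using nT \<delta> by simp
  note tail = gaussian_sequence_posterior_tail[OF I pars(1) s(1) orth nd B']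
  show "0 \<le> E" unfolding E_def posterior_def li pr dl by (rule tail(1))
  have E: "E \<le> (\<Sum>x\<in>I. shrink \<sigma> (s x) * \<sigma>\<^sup>2 + (shrink \<sigma> (s x))\<^sup>2 * \<sigma>\<^sup>2
      + (1 - shrink \<sigma> (s x))\<^sup>2 * (th0 x)\<^sup>2) / (real n * real T * \<delta>\<^sup>2)"
    unfolding E_def posterior_def li pr dl by (rule tail(2))
  have bias: "(1 - shrink \<sigma> (s x))\<^sup>2 * (th0 x)\<^sup>2
      \<le> (1 + \<sigma>\<^sup>2) * (c powr (- (p * a)) * (real (fst x) powr p * real (snd x) powr (2 * \<gamma>) * (th0 x)\<^sup>2))"
    if x: "x \<in> I" for x
  proof -
    have "v x powr (- a) = c powr (- (p * a)) * real (fst x) powr (p * a) * real (snd x) powr (2 * \<gamma>)"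
      using pos[OF x] pars q by (simp add: v_def powr_mult powr_powr a_def)
    \<comment> \<open>The choice of \<open>a\<close> makes \<open>q * a\<close> equal to
      \<open>2 * \<gamma>\<close>, the exact weight of \<open>j\<close> in the smoothness condition;
      for \<open>m\<close> the exponent \<open>p * a\<close> is raised to \<open>p\<close>, allowed
      since \<open>a \<le> 1\<close> and \<open>m \<ge> 1\<close>.\<close>
    also have "\<dots> \<le> c powr (- (p * a)) * real (fst x) powr p * real (snd x) powr (2 * \<gamma>)"
      using pos[OF x] p a by (intro mult_right_mono mult_left_mono powr_mono) (auto simp: mult_left_le)
    finally have va: "(1 + \<sigma>\<^sup>2) * v x powr (- a)
        \<le> (1 + \<sigma>\<^sup>2) * (c powr (- (p * a)) * real (fst x) powr p * real (snd x) powr (2 * \<gamma>))"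
      by (intro mult_left_mono) auto
    have "(1 - shrink \<sigma> (s x))\<^sup>2 \<le> (1 + \<sigma>\<^sup>2) * v x powr (- a)"
      using shrinkage_bounds(2)[OF pars(1) v[OF x] a] by (simp add: shrink_def s(2)[OF x])
    from mult_right_mono[OF order_trans[OF this va], of "(th0 x)\<^sup>2"] show ?thesis
      by (simp add: mult.assoc)
  qed
  have var: "shrink \<sigma> (s x) * \<sigma>\<^sup>2 + (shrink \<sigma> (s x))\<^sup>2 * \<sigma>\<^sup>2 \<le> 2 * (1 + \<sigma>\<^sup>2) * min 1 (v x)"
    if x: "x \<in> I" for x
    using shrinkage_bounds(1)[OF pars(1) v[OF x] a] by (simp add: shrink_def s(2)[OF x])
  have "(\<Sum>x\<in>I. shrink \<sigma> (s x) * \<sigma>\<^sup>2 + (shrink \<sigma> (s x))\<^sup>2 * \<sigma>\<^sup>2 + (1 - shrink \<sigma> (s x))\<^sup>2 * (th0 x)\<^sup>2)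
      \<le> (\<Sum>x\<in>I. 2 * (1 + \<sigma>\<^sup>2) * min 1 (v x)
          + (1 + \<sigma>\<^sup>2) * (c powr (- (p * a)) * (real (fst x) powr p * real (snd x) powr (2 * \<gamma>) * (th0 x)\<^sup>2)))"
    by (intro sum_mono add_mono bias var)
  also have "\<dots> = (1 + \<sigma>\<^sup>2) * (2 * (\<Sum>x\<in>I. min 1 (v x))
      + c powr (- (p * a)) * (\<Sum>x\<in>I. real (fst x) powr p * real (snd x) powr (2 * \<gamma>) * (th0 x)\<^sup>2))"
    by (simp only: sum.distrib sum_distrib_left[symmetric]) (simp add: algebra_simps)
  also have "(\<Sum>x\<in>I. min 1 (v x)) = S"
    unfolding S_def I_def Iset_def v_def p_def q_def by (simp add: sum.cartesian_product split_def)
  also have "(\<Sum>x\<in>I. real (fst x) powr p * real (snd x) powr (2 * \<gamma>) * (th0 x)\<^sup>2)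
      = (\<Sum>i=1..n. \<Sum>j=1..T. real i powr (2 * \<beta> / r) * real j powr (2 * \<gamma>) * (th0 (i, j))\<^sup>2)"
    unfolding I_def Iset_def p_def by (simp add: sum.cartesian_product split_def)
  also have "(1 + \<sigma>\<^sup>2) * (2 * S + c powr (- (p * a)) * \<dots>)
      \<le> (1 + \<sigma>\<^sup>2) * (2 * S + c powr (- (p * a)) * (real n * real T * Q\<^sup>2))"
    using truth by (intro mult_left_mono add_left_mono) auto
  also have "p * a = 4 * \<beta> * \<gamma> / (r * (2 * \<gamma> + 1))" by (simp add: p_def a_def q_def)
  finally show "E \<le> (1 + \<sigma>\<^sup>2) * (2 * S + c powr (- (4 * \<beta> * \<gamma> / (r * (2 * \<gamma> + 1)))) * (real n * real T * Q\<^sup>2))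
               / (real n * real T * \<delta>\<^sup>2)"
    using nd by (intro order_trans[OF E] divide_right_mono) auto
qed

text \<open>The tail bound holds eventually for all radii \<delta> at once, so \<delta> may vary
  with \<open>n\<close>. The radius \<open>(M n - L) / 2\<close> inverts the comparison
  \<open>dst\<close>; it still diverges, and \<open>C / \<delta>\<^sup>2\<close> tends to 0. Both
  metrics of the result are served by one tail bound.\<close>

lemma posterior_contractsI:
  fixes d dst :: "nat \<Rightarrow> 'p \<Rightarrow> real" and eps eps' :: "nat \<Rightarrow> real"
  assumes tail: "\<forall>\<^sub>F n in sequentially. \<forall>B \<delta>. \<delta> > 0 \<longrightarrow> B \<subseteq> {th. \<delta> * eps n \<le> d n th} \<longrightarrow>
        0 \<le> (\<integral>Y. Post n B Y \<partial>P n) \<and> (\<integral>Y. Post n B Y \<partial>P n) \<le> C / \<delta>\<^sup>2"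
    and dst: "\<forall>\<^sub>F n in sequentially. \<forall>th. dst n th \<le> 2 * d n th + L * eps' n"
    and eps: "\<forall>\<^sub>F n in sequentially. 0 \<le> eps n \<and> eps n \<le> eps' n"
  shows "posterior_contracts Post P dst eps'"
  unfolding posterior_contracts_def
proof (intro allI impI)
  fix M :: "nat \<Rightarrow> real" assume M: "filterlim M at_top sequentially"
  define M' where "M' n = (M n - L) / 2" for n
  have M': "filterlim M' at_top sequentially"
    unfolding filterlim_at_top
  proof
    fix z :: real
    have "\<forall>\<^sub>F n in sequentially. 2 * z + L \<le> M n" using M by (simp add: filterlim_at_top)
    then show "\<forall>\<^sub>F n in sequentially. z \<le> M' n"
      by eventually_elim (simp add: M'_def field_simps)
  qed
  have ev: "\<forall>\<^sub>F n in sequentially. 0 \<le> (\<integral>Y. Post n {th. dst n th > M n * eps' n} Y \<partial>P n) \<and>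
      (\<integral>Y. Post n {th. dst n th > M n * eps' n} Y \<partial>P n) \<le> C / (M' n)\<^sup>2"
    using tail dst eps filterlim_at_top_dense[THEN iffD1, OF M', rule_format, of 0]
  proof eventually_elim
    case (elim n)
    have "{th. dst n th > M n * eps' n} \<subseteq> {th. M' n * eps n \<le> d n th}"
    proof clarify
      fix th assume "M n * eps' n < dst n th"
      moreover have "dst n th \<le> 2 * d n th + L * eps' n" using elim by blast
      moreover have "M' n * eps n \<le> M' n * eps' n" using elim by (intro mult_left_mono) auto
      moreover have "2 * (M' n * eps' n) = M n * eps' n - L * eps' n"
        by (simp add: M'_def field_simps)
      ultimately show "M' n * eps n \<le> d n th" by linarith
    qed
    then show ?case using elim by blast
  qed
  have "(\<lambda>n. C / (M' n)\<^sup>2) \<longlonglongrightarrow> 0"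
    by (intro real_tendsto_divide_at_top[OF tendsto_const] filterlim_pow_at_top M') auto
  then show "(\<lambda>n. \<integral>Y. Post n {th. dst n th > M n * eps' n} Y \<partial>P n) \<longlonglongrightarrow> 0"
    by (rule tendsto_sandwich[OF _ _ tendsto_const, rotated 2]) (use ev in \<open>auto elim: eventually_mono\<close>)
qed

text \<open>Reduces everything to two deterministic conditions on \<open>c\<close> and
  \<open>eps\<close>: the truncated variance sum is of order \<open>n T eps\<^sup>2\<close> and the
  bias power of \<open>c\<close> is at most \<open>eps\<^sup>2\<close>.\<close>

lemma model_resultI:
  fixes T :: "nat \<Rightarrow> nat" and e psi :: "nat \<Rightarrow> nat \<Rightarrow> nat \<Rightarrow> real" and th0 :: "nat \<Rightarrow> nat \<times> nat \<Rightarrow> real"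
    and c eps :: "nat \<Rightarrow> real" and \<sigma> \<beta> \<gamma> r Q K :: real
  assumes pars: "\<sigma> > 0" "\<beta> > 0" "\<gamma> > 0" "r > 0"
    and T: "filterlim T at_top sequentially"
    and e: "\<And>n. n \<ge> 1 \<Longrightarrow> \<forall>m\<in>{1..n}. \<forall>m'\<in>{1..n}. (\<Sum>i=1..n. e n m i * e n m' i) = (if m = m' then 1 else 0)"
    and psi: "\<And>n. orthogonal_basis_matrix (T n) (psi n)"
    and truth: "\<And>n. (\<Sum>i=1..n. \<Sum>j=1..T n. real i powr (2 * \<beta> / r) * real j powr (2 * \<gamma>) * (th0 n (i, j))\<^sup>2)
                  \<le> real n * real (T n) * Q\<^sup>2"
    and pos: "\<forall>\<^sub>F n in sequentially. c n > 0 \<and> eps n > 0"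
    and var: "\<forall>\<^sub>F n in sequentially.
        (\<Sum>m=1..n. \<Sum>j=1..T n. min 1 (c n powr (2 * \<beta> / r) * real m powr (- (2 * \<beta> / r)) * real j powr (- (2 * \<gamma> + 1))))
          \<le> K * (real n * real (T n) * (eps n)\<^sup>2)"
    and bias: "\<forall>\<^sub>F n in sequentially. c n powr (- (4 * \<beta> * \<gamma> / (r * (2 * \<gamma> + 1)))) \<le> (eps n)\<^sup>2"
  shows "model_result T e psi \<sigma> \<beta> \<gamma> r th0 c eps"
proof -
  let ?Post = "\<lambda>n. posterior n (T n) (e n) (psi n) \<sigma> (prior n (T n) (c n) \<beta> \<gamma> r)"
  let ?P = "\<lambda>n. data_law n (T n) (ftrend n (T n) (e n) (psi n) (th0 n)) \<sigma>"
  let ?d = "\<lambda>n th. dn n (T n) (ftrend n (T n) (e n) (psi n) th) (ftrend n (T n) (e n) (psi n) (th0 n))"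
  let ?C = "(1 + \<sigma>\<^sup>2) * (2 * K + Q\<^sup>2)"
  have n1: "\<forall>\<^sub>F n in sequentially. n \<ge> (1::nat)" by (rule eventually_ge_at_top)
  have T1: "\<forall>\<^sub>F n in sequentially. T n \<ge> 1" using T by (simp add: filterlim_at_top)
  have tail: "\<forall>\<^sub>F n in sequentially. \<forall>B \<delta>. \<delta> > 0 \<longrightarrow> B \<subseteq> {th. \<delta> * eps n \<le> ?d n th} \<longrightarrow>
        0 \<le> (\<integral>Y. ?Post n B Y \<partial>?P n) \<and> (\<integral>Y. ?Post n B Y \<partial>?P n) \<le> ?C / \<delta>\<^sup>2"
    using n1 T1 pos var bias
  proof eventually_elim
    case (elim n)
    show ?case
    proof (intro allI impI)
      fix B \<delta> assume \<delta>: "\<delta> > 0" and B: "B \<subseteq> {th. \<delta> * eps n \<le> ?d n th}"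
      let ?N = "real n * real (T n)"
      let ?S = "\<Sum>m=1..n. \<Sum>j=1..T n. min 1 (c n powr (2 * \<beta> / r) * real m powr (- (2 * \<beta> / r)) * real j powr (- (2 * \<gamma> + 1)))"
      let ?A = "c n powr (- (4 * \<beta> * \<gamma> / (r * (2 * \<gamma> + 1))))"
      have N: "?N > 0" using elim by simp
      have eps: "eps n > 0" and cn: "c n > 0" using elim by auto
      have \<delta>': "\<delta> * eps n > 0" using \<delta> eps by simp
      note b = posterior_tail_bound[OF elim(1,2) pars(1) cn pars(2-4) \<delta>' e[OF elim(1)] psi truth B]
      have "2 * ?S + ?A * (?N * Q\<^sup>2) \<le> 2 * (K * (?N * (eps n)\<^sup>2)) + (eps n)\<^sup>2 * (?N * Q\<^sup>2)"
        using elim N by (intro add_mono mult_left_mono mult_right_mono) auto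
      then have "(1 + \<sigma>\<^sup>2) * (2 * ?S + ?A * (?N * Q\<^sup>2)) / (?N * (\<delta> * eps n)\<^sup>2)
          \<le> (1 + \<sigma>\<^sup>2) * (2 * (K * (?N * (eps n)\<^sup>2)) + (eps n)\<^sup>2 * (?N * Q\<^sup>2)) / (?N * (\<delta> * eps n)\<^sup>2)"
        using N by (intro divide_right_mono mult_left_mono) auto
      also have "\<dots> = ?C * (?N * (eps n)\<^sup>2) / (\<delta>\<^sup>2 * (?N * (eps n)\<^sup>2))"
        by (simp add: power_mult_distrib algebra_simps)
      also have "\<dots> = ?C / \<delta>\<^sup>2"
        using elim N eps by (intro nonzero_mult_divide_mult_cancel_right) simp
      finally show "0 \<le> (\<integral>Y. ?Post n B Y \<partial>?P n) \<and> (\<integral>Y. ?Post n B Y \<partial>?P n) \<le> ?C / \<delta>\<^sup>2"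
        using b by linarith
    qed
  qed
  \<comment> \<open>For \<open>dn\<close> itself the comparison is trivial: a nonnegative distance
    is at most twice itself.\<close>
  have "posterior_contracts ?Post ?P ?d eps"
    by (rule posterior_contractsI[OF tail, where L = 0])
       (use pos in \<open>auto elim: eventually_mono simp: dn_def sum_nonneg\<close>)
  moreover have "posterior_contracts ?Post ?P
      (\<lambda>n th. dL2 n (\<lambda>i. lin_interp (T n) (ftrend n (T n) (e n) (psi n) th i)) (F n))
      (\<lambda>n. max (eps n) (1 / real (T n)))"
    if Lip: "\<exists>L. \<forall>n. \<forall>i\<in>{1..n}. \<forall>s\<in>{0..1}. \<forall>t\<in>{0..1}. \<bar>F n i s - F n i t\<bar> \<le> L * \<bar>s - t\<bar>"
      and grid: "\<forall>n. \<forall>i\<in>{1..n}. \<forall>k\<in>{1..T n}.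
            F n i (real k / real (T n)) = ftrend n (T n) (e n) (psi n) (th0 n) i k"
    for F :: "nat \<Rightarrow> nat \<Rightarrow> real \<Rightarrow> real"
  proof -
    obtain L0 where L0: "\<And>n i s t. i \<in> {1..n} \<Longrightarrow> s \<in> {0..1} \<Longrightarrow> t \<in> {0..1} \<Longrightarrow> \<bar>F n i s - F n i t\<bar> \<le> L0 * \<bar>s - t\<bar>"
      using Lip by blast
    \<comment> \<open>The absolute value makes the Lipschitz constant nonnegative without an appeal
      to the Lipschitz bound.\<close>
    define L where "L = \<bar>L0\<bar>"
    have L: "L \<ge> 0" "\<bar>F n i s - F n i t\<bar> \<le> L * \<bar>s - t\<bar>"
      if "i \<in> {1..n}" "s \<in> {0..1}" "t \<in> {0..1}" for n i s t
      using order_trans[OF L0[OF that] mult_right_mono[OF abs_ge_self abs_ge_zero]] by (auto simp: L_def)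
    have L_nonneg: "L \<ge> 0" by (simp add: L_def)
    show ?thesis
    proof (rule posterior_contractsI[OF tail, where L = "2 * L"])
      show "\<forall>\<^sub>F n in sequentially. \<forall>th. dL2 n (\<lambda>i. lin_interp (T n) (ftrend n (T n) (e n) (psi n) th i)) (F n)
          \<le> 2 * ?d n th + 2 * L * max (eps n) (1 / real (T n))"
        using n1 T1
      proof eventually_elim
        case (elim n)
        have "2 * L * (1 / real (T n)) \<le> 2 * L * max (eps n) (1 / real (T n))"
          using L_nonneg by (intro mult_left_mono) auto
        moreover have "dL2 n (\<lambda>i. lin_interp (T n) (ftrend n (T n) (e n) (psi n) th i)) (F n)
            \<le> 2 * ?d n th + 2 * L * (1 / real (T n))" for th
          using grid by (intro dL2_lin_interp_le elim L_nonneg L(2)) auto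
        ultimately show ?case by (meson add_left_mono order_trans)
      qed
      show "\<forall>\<^sub>F n in sequentially. 0 \<le> eps n \<and> eps n \<le> max (eps n) (1 / real (T n))"
        using pos by (auto elim: eventually_mono)
    qed
  qed
  ultimately show ?thesis unfolding model_result_def by blast
qed

section \<open>The three smoothness regimes\<close>

theorem theorem5:
  fixes Eg :: "nat \<Rightarrow> nat \<Rightarrow> nat \<Rightarrow> bool"
    and lam :: "nat \<Rightarrow> nat \<Rightarrow> real"
    and e :: "nat \<Rightarrow> nat \<Rightarrow> nat \<Rightarrow> real"
    and T :: "nat \<Rightarrow> nat"
    and psi :: "nat \<Rightarrow> nat \<Rightarrow> nat \<Rightarrow> real"
    and th0 :: "nat \<Rightarrow> nat \<times> nat \<Rightarrow> real"
    and r \<beta> \<gamma> Q \<sigma> :: real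
  assumes r: "r \<ge> 1"
    and graph: "\<And>n. n \<ge> 1 \<Longrightarrow> connected_graph n (Eg n) \<and> laplacian_eigensystem n (Eg n) (lam n) (e n)"
    and eigs: "\<exists>C1 C2. C1 > 0 \<and> C2 > 0 \<and> (\<forall>n\<ge>1. \<forall>i\<in>{2..n}.
                 C1 * (real i / real n) powr (2 / r) \<le> lam n i \<and>
                 lam n i \<le> C2 * (real i / real n) powr (2 / r))"
    and wav: "\<And>n. orthogonal_basis_matrix (T n) (psi n)"
    and Tlim: "filterlim T at_top sequentially"
    and pars: "\<beta> > 0" "\<gamma> > 0" "\<beta> > r / 2" "Q > 0" "\<sigma> > 0"
    and truth: "\<And>n. (\<Sum>i=1..n. \<Sum>j=1..T n. real i powr (2 * \<beta> / r) * real j powr (2 * \<gamma>) * (th0 n (i, j))\<^sup>2)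
                      \<le> real n * real (T n) * Q\<^sup>2"
  shows
   "(2 * \<beta> < r * (2 * \<gamma> + 1) \<longrightarrow>
       model_result T e psi \<sigma> \<beta> \<gamma> r th0
         (\<lambda>n. (real n * real (T n)) powr (r * (2 * \<gamma> + 1) / (4 * \<beta> * \<gamma> + 2 * r * \<gamma> + r)))
         (\<lambda>n. (real n * real (T n)) powr (- (2 * \<beta> * \<gamma>) / (4 * \<beta> * \<gamma> + 2 * r * \<gamma> + r)))) \<and>
    (2 * \<beta> > r * (2 * \<gamma> + 1) \<longrightarrow>
       model_result T e psi \<sigma> \<beta> \<gamma> r th0
         (\<lambda>n. (real n * real (T n)) powr (r / (2 * \<beta>)))
         (\<lambda>n. (real n * real (T n)) powr (- \<gamma> / (2 * \<gamma> + 1)))) \<and>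
    (2 * \<beta> = r * (2 * \<gamma> + 1) \<longrightarrow>
       model_result T e psi \<sigma> \<beta> \<gamma> r th0
         (\<lambda>n. (real n * real (T n) / ln (real n * real (T n))) powr (1 / (2 * \<gamma> + 1)))
         (\<lambda>n. (real n * real (T n) / ln (real n * real (T n))) powr (- \<gamma> / (2 * \<gamma> + 1))))"
proof -
  define N where "N n = real n * real (T n)" for n
  define p where "p = 2 * \<beta> / r"
  define q where "q = 2 * \<gamma> + 1"
  define D where "D = 4 * \<beta> * \<gamma> + 2 * r * \<gamma> + r"
  have r0: "r > 0" using r by simp
  have p: "p > 1" using pars r0 by (simp add: p_def)
  have q: "q > 1" using pars by (simp add: q_def)
  have D: "D > 0" using pars r0 by (simp add: D_def add_pos_pos)
  \<comment> \<open>The bound 3 exceeds \<open>exp 1\<close>, so that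
    \<open>ln (N n) \<ge> 1\<close> in the critical regime; elsewhere positivity of
    \<open>N n\<close> is what is used.\<close>
  have N3: "\<forall>\<^sub>F n in sequentially. n \<ge> 1 \<and> T n \<ge> 1 \<and> N n \<ge> 3"
  proof -
    have "\<forall>\<^sub>F n in sequentially. n \<ge> (1::nat)" by (rule eventually_ge_at_top)
    moreover have "\<forall>\<^sub>F n in sequentially. T n \<ge> 3" using Tlim by (simp add: filterlim_at_top)
    ultimately show ?thesis
    proof eventually_elim
      case (elim n)
      then have "1 * 3 \<le> N n" unfolding N_def by (intro mult_mono) auto
      then show ?case using elim by auto
    qed
  qed
  have e: "\<forall>m\<in>{1..n}. \<forall>m'\<in>{1..n}. (\<Sum>i=1..n. e n m i * e n m' i) = (if m = m' then 1 else 0)"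
    if "n \<ge> 1" for n
    using graph[OF that] unfolding laplacian_eigensystem_def by blast
  note I = model_resultI[OF pars(5,1,2) r0 Tlim e wav truth, folded N_def p_def q_def]
  \<comment> \<open>Exchanges the roles of \<open>m\<close> and \<open>j\<close>, for the regime
    where the graph exponent \<open>p\<close> is the smaller one.\<close>
  have swap: "(\<Sum>m=1..n. \<Sum>j=1..k. min 1 (A * real m powr (- p) * real j powr (- q)))
      = (\<Sum>j=1..k. \<Sum>m=1..n. min 1 (A * real j powr (- q) * real m powr (- p)))" for A n k
    by (subst sum.swap) (simp add: mult_ac)
  have "model_result T e psi \<sigma> \<beta> \<gamma> r th0 (\<lambda>n. N n powr (r * q / D)) (\<lambda>n. N n powr (- (2 * \<beta> * \<gamma>) / D))"
    if case1: "2 * \<beta> < r * (2 * \<gamma> + 1)"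
  proof -
    \<comment> \<open>Here \<open>p < q\<close>: summing over \<open>m\<close> first leaves a
      convergent sum in \<open>j\<close>, and the variance is of order \<open>c n\<close>.\<close>
    have "q / p > 1" using case1 r0 pars by (simp add: p_def q_def field_simps)
    then obtain C where C: "C > 0" "\<And>k. (\<Sum>j=1..k. real j powr (- (q / p))) \<le> C"
      using sum_powr_bounded by metis
    show ?thesis
    proof (rule I[where K = "2 powr p / (p - 1) * C"])
      show "\<forall>\<^sub>F n in sequentially. 0 < N n powr (r * q / D) \<and> 0 < N n powr (- (2 * \<beta> * \<gamma>) / D)"
        using N3 by eventually_elim auto
      show "\<forall>\<^sub>F n in sequentially.
          (\<Sum>m=1..n. \<Sum>j=1..T n. min 1 ((N n powr (r * q / D)) powr p * real m powr (- p) * real j powr (- q)))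
          \<le> 2 powr p / (p - 1) * C * (N n * (N n powr (- (2 * \<beta> * \<gamma>) / D))\<^sup>2)"
        using N3
      proof eventually_elim
        case (elim n)
        let ?c = "N n powr (r * q / D)"
        have Npos: "N n > 0" using elim by simp
        have "(\<Sum>m=1..n. \<Sum>j=1..T n. min 1 (?c powr p * real m powr (- p) * real j powr (- q)))
            \<le> 2 powr p / (p - 1) * (?c powr p) powr (1 / p) * (\<Sum>j=1..T n. real j powr (- q / p))"
          unfolding swap using Npos p by (intro double_sum_min_powr_le) auto
        also have "\<dots> \<le> 2 powr p / (p - 1) * (?c powr p) powr (1 / p) * C"
          using C(2)[of "T n"] p by (intro mult_left_mono) auto
        also have "(?c powr p) powr (1 / p) = N n * (N n powr (- (2 * \<beta> * \<gamma>) / D))\<^sup>2"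
        proof -
          have "(?c powr p) powr (1 / p) = N n powr (r * q / D)" using Npos p by (simp add: powr_powr)
          moreover
          \<comment> \<open>Since \<open>D = r * q + 4 * \<beta> * \<gamma>\<close>, the chosen
            \<open>c n\<close> equals \<open>N n\<close> times the squared rate, which balances
            variance and bias.\<close>
          have "r * q / D = 1 + 2 * (- (2 * \<beta> * \<gamma>) / D)"
            using D by (simp add: field_simps) (simp add: D_def q_def algebra_simps)
          ultimately show ?thesis
            using Npos by (simp only: powr_add) (simp add: powr_power power2_eq_square flip: powr_add)
        qed
        finally show ?case by (simp add: mult_ac)
      qed
      show "\<forall>\<^sub>F n in sequentially. (N n powr (r * q / D)) powr (- (4 * \<beta> * \<gamma> / (r * q)))
          \<le> (N n powr (- (2 * \<beta> * \<gamma>) / D))\<^sup>2"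
        using N3
      proof eventually_elim
        case (elim n)
        have "r * q / D * - (4 * \<beta> * \<gamma> / (r * q)) = - (2 * \<beta> * \<gamma>) / D + - (2 * \<beta> * \<gamma>) / D"
          using r0 q D by (simp add: field_simps)
        then show ?case by (simp only: powr_powr power2_eq_square powr_add[symmetric])
      qed
    qed
  qed
  moreover have "model_result T e psi \<sigma> \<beta> \<gamma> r th0 (\<lambda>n. N n powr (r / (2 * \<beta>))) (\<lambda>n. N n powr (- \<gamma> / q))"
    if case2: "2 * \<beta> > r * (2 * \<gamma> + 1)"
  proof -
    \<comment> \<open>Here \<open>p > q\<close>: summing over \<open>j\<close> first leaves a
      convergent sum in \<open>m\<close>. The choice of \<open>c\<close> makes
      \<open>c n powr p\<close> equal to \<open>N n\<close>, so the variance is of order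
      \<open>N n powr (1 / q)\<close>.\<close>
    have "r * q < 2 * \<beta>" "r * q > 0" using case2 r0 q by (auto simp: q_def)
    then have "p / q > 1" by (simp add: p_def less_divide_eq)
    then obtain C where C: "C > 0" "\<And>n. (\<Sum>m=1..n. real m powr (- (p / q))) \<le> C"
      using sum_powr_bounded by metis
    show ?thesis
    proof (rule I[where K = "2 powr q / (q - 1) * C"])
      show "\<forall>\<^sub>F n in sequentially. 0 < N n powr (r / (2 * \<beta>)) \<and> 0 < N n powr (- \<gamma> / q)"
        using N3 by eventually_elim auto
      show "\<forall>\<^sub>F n in sequentially.
          (\<Sum>m=1..n. \<Sum>j=1..T n. min 1 ((N n powr (r / (2 * \<beta>))) powr p * real m powr (- p) * real j powr (- q)))
          \<le> 2 powr q / (q - 1) * C * (N n * (N n powr (- \<gamma> / q))\<^sup>2)"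
        using N3
      proof eventually_elim
        case (elim n)
        let ?c = "N n powr (r / (2 * \<beta>))"
        have Npos: "N n > 0" using elim by simp
        have "(\<Sum>m=1..n. \<Sum>j=1..T n. min 1 (?c powr p * real m powr (- p) * real j powr (- q)))
            \<le> 2 powr q / (q - 1) * (?c powr p) powr (1 / q) * (\<Sum>m=1..n. real m powr (- p / q))"
          using Npos q by (intro double_sum_min_powr_le) auto
        also have "\<dots> \<le> 2 powr q / (q - 1) * (?c powr p) powr (1 / q) * C"
          using C(2)[of n] q by (intro mult_left_mono) auto
        also have "(?c powr p) powr (1 / q) = N n powr (1 / q)"
          using Npos pars r0 by (simp add: powr_powr p_def)
        also have "\<dots> = N n * (N n powr (- \<gamma> / q))\<^sup>2"
        proof -
          have "1 / q = 1 + 2 * (- \<gamma> / q)"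
            using q by (simp add: field_simps) (simp add: q_def algebra_simps)
          then show ?thesis
            using Npos by (simp only: powr_add) (simp add: powr_power power2_eq_square flip: powr_add)
        qed
        finally show ?case by (simp add: mult_ac)
      qed
      show "\<forall>\<^sub>F n in sequentially. (N n powr (r / (2 * \<beta>))) powr (- (4 * \<beta> * \<gamma> / (r * q)))
          \<le> (N n powr (- \<gamma> / q))\<^sup>2"
        using N3
      proof eventually_elim
        case (elim n)
        have "r / (2 * \<beta>) * - (4 * \<beta> * \<gamma> / (r * q)) = - \<gamma> / q + - \<gamma> / q"
          using r0 q pars by (simp add: field_simps)
        then show ?case by (simp only: powr_powr power2_eq_square powr_add[symmetric])
      qed
    qed
  qed
  moreover have "model_result T e psi \<sigma> \<beta> \<gamma> r th0
      (\<lambda>n. (N n / ln (N n)) powr (1 / q)) (\<lambda>n. (N n / ln (N n)) powr (- \<gamma> / q))"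
    if case3: "2 * \<beta> = r * (2 * \<gamma> + 1)"
  proof -
    \<comment> \<open>With equal exponents neither order of summation leaves a convergent sum; the
      remaining sum is harmonic.\<close>
    have pq: "p = q" using case3 r0 by (simp add: p_def q_def)
    have lnN: "ln (N n) \<ge> 1" if "N n \<ge> 3" for n
    proof -
      have "exp 1 \<le> N n" using exp_le that by linarith
      then show ?thesis using that by (subst ln_ge_iff) auto
    qed
    show ?thesis
    proof (rule I[where K = "2 powr q / (q - 1) * 2"])
      show "\<forall>\<^sub>F n in sequentially. 0 < (N n / ln (N n)) powr (1 / q) \<and> 0 < (N n / ln (N n)) powr (- \<gamma> / q)"
        using N3 by eventually_elim (auto dest: lnN)
      show "\<forall>\<^sub>F n in sequentially.
          (\<Sum>m=1..n. \<Sum>j=1..T n. min 1 (((N n / ln (N n)) powr (1 / q)) powr p * real m powr (- p) * real j powr (- q)))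
          \<le> 2 powr q / (q - 1) * 2 * (N n * ((N n / ln (N n)) powr (- \<gamma> / q))\<^sup>2)"
        using N3
      proof eventually_elim
        case (elim n)
        let ?X = "N n / ln (N n)"
        let ?c = "?X powr (1 / q)"
        have l: "ln (N n) \<ge> 1" using lnN elim by blast
        have X: "?X > 0" using elim l by simp
        have "real n * 1 \<le> N n" unfolding N_def using elim by (intro mult_left_mono) auto
        then have "ln (real n) \<le> ln (N n)" using elim by (subst ln_le_cancel_iff) auto
        moreover have "- q / q = -1" using q by simp
        \<comment> \<open>From \<open>1 + ln n \<le> 2 * ln (N n)\<close>, as
          \<open>ln (N n) \<ge> 1\<close>; this is the factor 2 in the constant
          \<open>K\<close>.\<close>
        ultimately have h: "(\<Sum>m=1..n. real m powr (- q / q)) \<le> 2 * ln (N n)"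
          using harmonic_sum_le[of n, OF conjunct1[OF elim]] l by (simp only:)
        have "(\<Sum>m=1..n. \<Sum>j=1..T n. min 1 (?c powr p * real m powr (- p) * real j powr (- q)))
            \<le> 2 powr q / (q - 1) * (?c powr q) powr (1 / q) * (\<Sum>m=1..n. real m powr (- q / q))"
          unfolding pq using X q by (intro double_sum_min_powr_le) auto
        also have "\<dots> \<le> 2 powr q / (q - 1) * (?c powr q) powr (1 / q) * (2 * ln (N n))"
          using q by (intro mult_left_mono h) auto
        also have "(?c powr q) powr (1 / q) = ?X * (?X powr (- \<gamma> / q))\<^sup>2"
        proof -
          have "(?c powr q) powr (1 / q) = ?X powr (1 / q)"
            using q by (simp only: powr_powr) simp
          moreover
          have "1 / q = 1 + 2 * (- \<gamma> / q)"
            using q by (simp add: field_simps) (simp add: q_def algebra_simps)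
          ultimately show ?thesis
            using X by (simp only: powr_add powr_one_gt_zero_iff[THEN iffD2] power2_eq_square mult_2)
        qed
        finally have bound: "(\<Sum>m=1..n. \<Sum>j=1..T n. min 1 (?c powr p * real m powr (- p) * real j powr (- q)))
            \<le> 2 powr q / (q - 1) * (?X * (?X powr (- \<gamma> / q))\<^sup>2) * (2 * ln (N n))" .
        \<comment> \<open>The logarithm from the harmonic sum cancels the one in \<open>?X\<close>
          and restores \<open>N n\<close>.\<close>
        have "a * (?X * y) * (2 * ln (N n)) = a * 2 * (N n * y)" for a y
          using l by simp
        with bound show ?case by (simp only:)
      qed
      show "\<forall>\<^sub>F n in sequentially. ((N n / ln (N n)) powr (1 / q)) powr (- (4 * \<beta> * \<gamma> / (r * q)))
          \<le> ((N n / ln (N n)) powr (- \<gamma> / q))\<^sup>2"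
        using N3
      proof eventually_elim
        case (elim n)
        have "4 * \<beta> * \<gamma> = 2 * \<gamma> * (r * q)" using case3 by (simp add: q_def)
        then have "1 / q * - (4 * \<beta> * \<gamma> / (r * q)) = - \<gamma> / q + - \<gamma> / q"
          using r0 q by (simp add: field_simps)
        then show ?case by (simp only: powr_powr power2_eq_square powr_add[symmetric])
      qed
    qed
  qed
  ultimately show ?thesis unfolding N_def q_def D_def by blast
qed

end
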